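(* Let $\delta>0$. There is a constant $A_0=A_0(\delta)$ such that for every $A\ge A_0$ the following holds for all integers $n\ge 2$. Let $w_1,\dots,w_n$ be real numbers with $\sum_{i=1}^n w_i=0$, $\sum_{i=1}^n w_i^2=1$, and $|w_i-w_j|\le \frac{1}{A\sqrt{\log n}}$ for all distinct $i,j$. Let $I\subset[n]$ with $|I|\ge\delta n$, and let $(v_1,\dots,v_n)$ be a real sequence with $v_i=i/n$ for all $i\in I$ (and $v_i$ arbitrary for $i\notin I$). Let $S_\pi=\sum_{i=1}^n w_i v_{\pi(i)}$, where $\pi$ is a uniformly random permutation of $[n]$. (a) There is a constant $K$ depending only on $A$ and $\delta$ such that for every $L\in\mathbb{R}$, $$\mathbb{P}\Big(|S_\pi-L|\le\frac1n\Big)\le\frac{K}{n}.$$ (b) If in addition $|v_i|\le\widetilde B$ for all $i\in[n]$, for some constant $\widetilde B>0$, then there are constants $K',c>0$ depending only on $A$, $\widetilde B$ and $\delta$ such that for every $L\in\mathbb{R}$, $$\mathbb{P}\Big(|S_\pi-L|\le\frac1n\Big)\le\frac{K'}{n}e^{-cL^2}.$$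
   Context: $[n]=\{1,\dots,n\}$. *)

theory Defs
  imports "HOL-Probability.Probability" "HOL-Combinatorics.Permutations"
begin

text \<open>
  The index set $[n]$ is \<open>{1..n}\<close>.  Real sequences of length \<open>n\<close> are functions
  \<open>nat \<Rightarrow> real\<close> of which only the values on \<open>{1..n}\<close> matter.
\<close>

definition uniform_perm :: "nat \<Rightarrow> (nat \<Rightarrow> nat) pmf" where
  "uniform_perm n = pmf_of_set {\<pi>. \<pi> permutes {1..n}}"

definition perm_sum :: "nat \<Rightarrow> (nat \<Rightarrow> real) \<Rightarrow> (nat \<Rightarrow> real) \<Rightarrow> (nat \<Rightarrow> nat) \<Rightarrow> real" where
  "perm_sum n w v \<pi> = (\<Sum>i=1..n. w i * v (\<pi> i))"

definition small_ball_prob :: "nat \<Rightarrow> (nat \<Rightarrow> real) \<Rightarrow> (nat \<Rightarrow> real) \<Rightarrow> real \<Rightarrow> real" where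
  "small_ball_prob n w v L =
     measure_pmf.prob (uniform_perm n) {\<pi>. \<bar>perm_sum n w v \<pi> - L\<bar> \<le> 1 / real n}"

definition admissible_weights :: "real \<Rightarrow> nat \<Rightarrow> (nat \<Rightarrow> real) \<Rightarrow> bool" where
  "admissible_weights A n w \<longleftrightarrow>
     (\<Sum>i=1..n. w i) = 0 \<and>
     (\<Sum>i=1..n. (w i)\<^sup>2) = 1 \<and>
     (\<forall>i\<in>{1..n}. \<forall>j\<in>{1..n}. i \<noteq> j \<longrightarrow> \<bar>w i - w j\<bar> \<le> 1 / (A * sqrt (ln (real n))))"

definition equispaced_on :: "real \<Rightarrow> nat \<Rightarrow> nat set \<Rightarrow> (nat \<Rightarrow> real) \<Rightarrow> bool" where
  "equispaced_on \<delta> n I v \<longleftrightarrow>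
     I \<subseteq> {1..n} \<and> real (card I) \<ge> \<delta> * real n \<and> (\<forall>i\<in>I. v i = real i / real n)"

end

theory Submission
  imports Defs
begin

text \<open>
  The Fourier transform of \<open>S\<^sub>\<pi>\<close> is bounded up to frequency \<open>2 n\<close>. Fix disjoint pairs of
  positions; composing \<open>\<pi>\<close> with their transpositions turns \<open>S\<^sub>\<pi>\<close> into a Rademacher sum, so the
  transform is controlled by the average over \<open>\<pi>\<close> of a product of factors
  \<open>exp (- sin\<^sup>2 (\<theta> (w i - w j) (v (\<pi> i) - v (\<pi> j)) / 2) / 4)\<close>. The pairs are revealed one by one.
  As long as only a fraction of the values is used up, a positive proportion of the remaining
  pairs of values lies in \<open>I\<close>, where \<open>v\<close> is an arithmetic progression, and each factor contributes
  \<open>1 - c min 1 (\<theta>\<^sup>2 (w i - w j)\<^sup>2)\<close>. The resulting bound is Gaussian in \<open>\<theta>\<close> for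
  \<open>\<theta> \<le> 2 A sqrt (ln n)\<close>, and at most \<open>1 / n\<close> after that if \<open>A\<close> is large; its integral is bounded.
  For (b) the same argument is applied to the exponentially tilted distribution.
\<close>

text \<open>The obstacle is resonance: at frequencies of order \<open>n\<close> the sines could
  vanish for most pairs of values. On \<open>I\<close> the argument of the sine is
  \<open>y (c - d)\<close> with \<open>y = \<theta> (w i - w j) / (2 n)\<close>, so for fixed
  \<open>c\<close> its zeros in \<open>d\<close> are spaced by \<open>pi / \<bar>y\<bar>\<close>.
  Small weight differences and \<open>\<theta> \<le> 2 n\<close> keep \<open>\<bar>y\<bar>\<close>
  below \<open>pi \<delta> / 32\<close>, hence the zeros are sparse compared with the density of
  \<open>I\<close>. Sparsity is proved by packing translates of the resonant set, without counting
  integers near the zeros. The cutoff \<open>2 n\<close> is where the transform of a Fejer kernel of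
  width \<open>1 / n\<close> ends. About \<open>\<delta> n / 4\<close> pairs are used: few enough to
  leave half of \<open>I\<close> unrevealed, and enough for the squared weight gaps to add up to at
  least \<open>\<delta> / 4\<close>. The tilt is split off by Cauchy-Schwarz, which calls for the
  moment generating function at twice the tilt; it is sub-Gaussian by an exchangeable pairs
  argument.\<close>

abbreviation perms :: "nat \<Rightarrow> (nat \<Rightarrow> nat) set" where
  "perms n \<equiv> {\<pi>. \<pi> permutes {1..n}}"

lemma finite_perms: "finite (perms n)"
  by (simp add: finite_permutations)

lemma card_perms: "card (perms n) = fact n"
  using card_permutations[of "{1..n}" n] by simp

lemma perms_nonempty: "perms n \<noteq> {}"
  using permutes_id by blast

section \<open>Transpositions and the moment generating function\<close>

lemma sum_perms_transpose:
  assumes "a \<in> {1..n}" "b \<in> {1..n}"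
  shows "(\<Sum>\<pi>\<in>perms n. f (\<pi> \<circ> Transposition.transpose a b)) = (\<Sum>\<pi>\<in>perms n. f \<pi>)"
  using sum_permutations_compose_right[OF permutes_swap_id[OF assms], of f] by simp

lemma perm_sum_transpose:
  assumes "a \<in> {1..n}" "b \<in> {1..n}"
  shows "perm_sum n w v (\<pi> \<circ> Transposition.transpose a b)
           = perm_sum n w v \<pi> - (w a - w b) * (v (\<pi> a) - v (\<pi> b))"
proof (cases "a = b")
  case False
  let ?g = "\<lambda>i. w i * v (\<pi> (Transposition.transpose a b i)) - w i * v (\<pi> i)"
  have "perm_sum n w v (\<pi> \<circ> Transposition.transpose a b) - perm_sum n w v \<pi> = (\<Sum>i\<in>{1..n}. ?g i)"
    by (simp add: perm_sum_def sum_subtractf)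
  also have "\<dots> = (\<Sum>i\<in>{a,b}. ?g i)"
    by (rule sum.mono_neutral_right) (use assms in \<open>auto simp: transpose_apply_other\<close>)
  also have "\<dots> = - (w a - w b) * (v (\<pi> a) - v (\<pi> b))"
    using False by (simp add: algebra_simps)
  finally show ?thesis by (simp add: algebra_simps)
qed (simp add: perm_sum_def)

text \<open>The pairwise form of a covariance. With \<open>g = v \<circ> \<pi>\<close> it writes the
  permutation sum through terms that are odd under transpositions; with \<open>g = f\<close> it
  evaluates the total squared spread of the weights.\<close>

lemma sum_diff_products:
  fixes f g :: "nat \<Rightarrow> real"
  assumes "(\<Sum>i=1..n. f i) = 0"
  shows "(\<Sum>i=1..n. \<Sum>j=1..n. (f i - f j) * (g i - g j)) = 2 * real n * (\<Sum>i=1..n. f i * g i)"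
proof -
  have "(\<Sum>i=1..n. \<Sum>j=1..n. (f i - f j) * (g i - g j))
      = (\<Sum>i=1..n. \<Sum>j=1..n. f i * g i + f j * g j - f i * g j - f j * g i)"
    by (simp add: algebra_simps)
  also have "\<dots> = 2 * real n * (\<Sum>i=1..n. f i * g i)
      - (\<Sum>i=1..n. f i) * (\<Sum>j=1..n. g j) - (\<Sum>j=1..n. f j) * (\<Sum>i=1..n. g i)"
    by (simp add: sum.distrib sum_subtractf flip: sum_distrib_left sum_distrib_right)
  finally show ?thesis using assms by simp
qed

text \<open>The tangent bound \<open>exp u \<ge> 1 + u\<close> is applied at the larger of the two
  exponents. Enlarging that exponential to the sum of both makes the right side symmetric, so that a
  transposition can later merge its two halves.\<close>

lemma exp_diff_mult_le:
  fixes a t x :: real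
  assumes "t \<ge> 0"
  shows "a * (exp x - exp (x - t * a)) \<le> t * a\<^sup>2 * (exp x + exp (x - t * a))"
proof (cases "a \<ge> 0")
  case True
  have "exp (x - t * a) = exp x * exp (- (t * a))" by (simp flip: exp_add)
  also have "\<dots> \<ge> exp x * (1 - t * a)"
    using exp_ge_add_one_self[of "- (t * a)"] by (intro mult_left_mono) auto
  finally have "exp x - exp (x - t * a) \<le> exp x * (t * a)" by (simp add: algebra_simps)
  then have "a * (exp x - exp (x - t * a)) \<le> a * (exp x * (t * a))"
    using True by (rule mult_left_mono)
  also have "\<dots> = t * a\<^sup>2 * exp x" by (simp add: power2_eq_square)
  also have "\<dots> \<le> t * a\<^sup>2 * (exp x + exp (x - t * a))"
    using assms by (intro mult_left_mono) auto
  finally show ?thesis .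
next
  case False
  define y where "y = x - t * a"
  have "exp x = exp y * exp (t * a)" by (simp add: y_def flip: exp_add)
  also have "\<dots> \<ge> exp y * (1 + t * a)"
    using exp_ge_add_one_self[of "t * a"] by (intro mult_left_mono) auto
  finally have "exp y - exp x \<le> exp y * (- t * a)" by (simp add: algebra_simps)
  then have "(- a) * (exp y - exp x) \<le> (- a) * (exp y * (- t * a))"
    using False by (intro mult_left_mono) auto
  also have "\<dots> = t * a\<^sup>2 * exp y" by (simp add: power2_eq_square)
  also have "\<dots> \<le> t * a\<^sup>2 * (exp x + exp y)"
    using assms by (intro mult_left_mono) auto
  finally show ?thesis by (simp add: y_def algebra_simps)
qed

text \<open>Exchangeable pairs: since the weights sum to zero, \<open>S\<close> is proportional to the sum of the terms
  \<open>(w i - w j) (v (\<pi> i) - v (\<pi> j))\<close>, each of which changes sign when \<open>\<pi>\<close> is composed with the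
  transposition of \<open>i\<close> and \<open>j\<close>. This bounds \<open>M' t\<close> by \<open>4 B\<^sup>2 t M t\<close> for the
  moment generating function \<open>M\<close>.\<close>

lemma perm_sum_mgf_deriv:
  fixes w v :: "nat \<Rightarrow> real"
  assumes w0: "(\<Sum>i=1..n. w i) = 0" and w1: "(\<Sum>i=1..n. (w i)\<^sup>2) = 1"
    and vB: "\<forall>i\<in>{1..n}. \<bar>v i\<bar> \<le> B" and t: "t \<ge> 0" and n: "n > 0"
  shows "(\<Sum>\<pi>\<in>perms n. perm_sum n w v \<pi> * exp (t * perm_sum n w v \<pi>))
           \<le> 4 * B\<^sup>2 * t * (\<Sum>\<pi>\<in>perms n. exp (t * perm_sum n w v \<pi>))"
proof -
  let ?S = "perm_sum n w v"
  define M where "M = (\<Sum>\<pi>\<in>perms n. exp (t * ?S \<pi>))"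
  define a where "a = (\<lambda>i j \<pi>. (w i - w j) * (v (\<pi> i) - v (\<pi> j)))"
  have S_eq: "2 * real n * ?S \<pi> = (\<Sum>i=1..n. \<Sum>j=1..n. a i j \<pi>)" for \<pi>
    using sum_diff_products[OF w0, of "\<lambda>i. v (\<pi> i)"] by (simp add: perm_sum_def a_def)
  have pair: "(\<Sum>\<pi>\<in>perms n. a i j \<pi> * exp (t * ?S \<pi>)) \<le> 4 * B\<^sup>2 * t * (w i - w j)\<^sup>2 * M"
    if ij: "i \<in> {1..n}" "j \<in> {1..n}" for i j
  proof -
    let ?\<tau> = "Transposition.transpose i j"
    have a_swap: "a i j (\<pi> \<circ> ?\<tau>) = - a i j \<pi>" for \<pi>
      by (simp add: a_def algebra_simps)
    have S_swap: "t * ?S (\<pi> \<circ> ?\<tau>) = t * ?S \<pi> - t * a i j \<pi>" for \<pi>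
      by (simp add: perm_sum_transpose[OF ij] a_def algebra_simps)
    have *: "(\<Sum>\<pi>\<in>perms n. a i j \<pi> * exp (t * ?S \<pi>))
        = (\<Sum>\<pi>\<in>perms n. - a i j \<pi> * exp (t * ?S \<pi> - t * a i j \<pi>))"
      using sum_perms_transpose[OF ij, of "\<lambda>\<pi>. a i j \<pi> * exp (t * ?S \<pi>)"]
      by (simp add: a_swap S_swap)
    \<comment> \<open>The squared term is even under the transposition, so both exponentials
      contribute equally after summation.\<close>
    have **: "(\<Sum>\<pi>\<in>perms n. t * (a i j \<pi>)\<^sup>2 * exp (t * ?S \<pi>))
        = (\<Sum>\<pi>\<in>perms n. t * (a i j \<pi>)\<^sup>2 * exp (t * ?S \<pi> - t * a i j \<pi>))"
      using sum_perms_transpose[OF ij, of "\<lambda>\<pi>. t * (a i j \<pi>)\<^sup>2 * exp (t * ?S \<pi>)"]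
      by (simp add: a_swap S_swap)
    \<comment> \<open>Averaging with the swapped sum turns an odd factor times \<open>exp\<close>
      into a difference of exponentials, which gains the factor \<open>t\<close>.\<close>
    have "2 * (\<Sum>\<pi>\<in>perms n. a i j \<pi> * exp (t * ?S \<pi>))
        = (\<Sum>\<pi>\<in>perms n. a i j \<pi> * (exp (t * ?S \<pi>) - exp (t * ?S \<pi> - t * a i j \<pi>)))"
      using * by (simp add: right_diff_distrib sum_subtractf sum_negf)
    also have "\<dots> \<le> (\<Sum>\<pi>\<in>perms n. t * (a i j \<pi>)\<^sup>2 *
        (exp (t * ?S \<pi>) + exp (t * ?S \<pi> - t * a i j \<pi>)))"
      using t by (intro sum_mono exp_diff_mult_le)
    also have "\<dots> = 2 * (\<Sum>\<pi>\<in>perms n. t * (a i j \<pi>)\<^sup>2 * exp (t * ?S \<pi>))"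
      using ** by (simp add: distrib_left sum.distrib)
    also have "\<dots> \<le> 2 * (\<Sum>\<pi>\<in>perms n. 4 * B\<^sup>2 * t * (w i - w j)\<^sup>2 * exp (t * ?S \<pi>))"
    proof (intro mult_left_mono sum_mono mult_right_mono)
      fix \<pi> assume "\<pi> \<in> perms n"
      then have "\<pi> i \<in> {1..n}" "\<pi> j \<in> {1..n}"
        using ij by (metis mem_Collect_eq permutes_in_image)+
      then have "\<bar>v (\<pi> i)\<bar> \<le> B" "\<bar>v (\<pi> j)\<bar> \<le> B" using vB by blast+
      then have "\<bar>v (\<pi> i) - v (\<pi> j)\<bar> \<le> 2 * B" by linarith
      then have "(v (\<pi> i) - v (\<pi> j))\<^sup>2 \<le> (2 * B)\<^sup>2"
        by (rule abs_le_square_iff[THEN iffD1, OF order_trans]) simp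
      then have "(w i - w j)\<^sup>2 * (v (\<pi> i) - v (\<pi> j))\<^sup>2 \<le> (w i - w j)\<^sup>2 * (2 * B)\<^sup>2"
        by (rule mult_left_mono) simp
      then have "t * (a i j \<pi>)\<^sup>2 \<le> t * ((w i - w j)\<^sup>2 * (2 * B)\<^sup>2)"
        using t by (intro mult_left_mono) (simp_all add: a_def power_mult_distrib)
      then show "t * (a i j \<pi>)\<^sup>2 \<le> 4 * B\<^sup>2 * t * (w i - w j)\<^sup>2"
        by (simp add: power2_eq_square algebra_simps)
    qed auto
    also have "\<dots> = 2 * (4 * B\<^sup>2 * t * (w i - w j)\<^sup>2 * M)"
      by (simp add: M_def sum_distrib_left)
    finally show ?thesis by linarith
  qed
  have "2 * real n * (\<Sum>\<pi>\<in>perms n. ?S \<pi> * exp (t * ?S \<pi>))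
      = (\<Sum>\<pi>\<in>perms n. (2 * real n * ?S \<pi>) * exp (t * ?S \<pi>))"
    by (simp add: sum_distrib_left mult.assoc)
  also have "\<dots> = (\<Sum>\<pi>\<in>perms n. \<Sum>i=1..n. \<Sum>j=1..n. a i j \<pi> * exp (t * ?S \<pi>))"
    by (simp only: S_eq sum_distrib_right)
  also have "\<dots> = (\<Sum>i=1..n. \<Sum>\<pi>\<in>perms n. \<Sum>j=1..n. a i j \<pi> * exp (t * ?S \<pi>))"
    by (rule sum.swap)
  also have "\<dots> = (\<Sum>i=1..n. \<Sum>j=1..n. \<Sum>\<pi>\<in>perms n. a i j \<pi> * exp (t * ?S \<pi>))"
    by (intro sum.cong refl sum.swap)
  also have "\<dots> \<le> (\<Sum>i=1..n. \<Sum>j=1..n. 4 * B\<^sup>2 * t * (w i - w j)\<^sup>2 * M)"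
    by (intro sum_mono pair) auto
  also have "\<dots> = 4 * B\<^sup>2 * t * M * (\<Sum>i=1..n. \<Sum>j=1..n. (w i - w j) * (w i - w j))"
    by (simp add: sum_distrib_left power2_eq_square mult_ac)
  also have "\<dots> = 4 * B\<^sup>2 * t * M * (2 * real n * (\<Sum>i=1..n. w i * w i))"
    by (simp only: sum_diff_products[OF w0])
  also have "\<dots> = 2 * real n * (4 * B\<^sup>2 * t * M)"
    using w1 by (simp add: power2_eq_square)
  finally have "(\<Sum>\<pi>\<in>perms n. ?S \<pi> * exp (t * ?S \<pi>)) \<le> 4 * B\<^sup>2 * t * M"
    using n by (subst (asm) mult_le_cancel_left_pos) auto
  then show ?thesis by (simp only: M_def)
qed

text \<open>A Gronwall argument: by the derivative bound, the moment generating function times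
  \<open>exp (- 2 B\<^sup>2 t\<^sup>2)\<close> is nonincreasing, and at \<open>t = 0\<close> it
  equals the number of permutations.\<close>

lemma perm_sum_mgf_nonneg:
  fixes w v :: "nat \<Rightarrow> real"
  assumes w0: "(\<Sum>i=1..n. w i) = 0" and w1: "(\<Sum>i=1..n. (w i)\<^sup>2) = 1"
    and vB: "\<forall>i\<in>{1..n}. \<bar>v i\<bar> \<le> B" and t: "t \<ge> 0" and n: "n > 0"
  shows "(\<Sum>\<pi>\<in>perms n. exp (t * perm_sum n w v \<pi>)) \<le> fact n * exp (2 * B\<^sup>2 * t\<^sup>2)"
proof -
  let ?S = "perm_sum n w v"
  define g where "g = (\<lambda>x. exp (- (2 * B\<^sup>2 * x\<^sup>2)) * (\<Sum>\<pi>\<in>perms n. exp (x * ?S \<pi>)))"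
  have "g t \<le> g 0"
  proof (rule DERIV_nonpos_imp_nonincreasing[OF t])
    fix x :: real assume "0 \<le> x"
    define M' where "M' = (\<Sum>\<pi>\<in>perms n. ?S \<pi> * exp (x * ?S \<pi>))"
    define M where "M = (\<Sum>\<pi>\<in>perms n. exp (x * ?S \<pi>))"
    have "((\<lambda>x. \<Sum>\<pi>\<in>perms n. exp (x * ?S \<pi>)) has_real_derivative M') (at x)"
      unfolding M'_def by (intro DERIV_sum) (auto intro!: derivative_eq_intros)
    moreover have "((\<lambda>x. exp (- (2 * B\<^sup>2 * x\<^sup>2))) has_real_derivative
        exp (- (2 * B\<^sup>2 * x\<^sup>2)) * (- (4 * B\<^sup>2 * x))) (at x)"
      by (auto intro!: derivative_eq_intros)
    ultimately have "(g has_real_derivative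
        exp (- (2 * B\<^sup>2 * x\<^sup>2)) * (- (4 * B\<^sup>2 * x)) * M + M' * exp (- (2 * B\<^sup>2 * x\<^sup>2))) (at x)"
      unfolding g_def M_def by (rule DERIV_mult[rotated])
    moreover have "M' \<le> 4 * B\<^sup>2 * x * M"
      unfolding M_def M'_def by (rule perm_sum_mgf_deriv[OF w0 w1 vB \<open>0 \<le> x\<close> n])
    then have "exp (- (2 * B\<^sup>2 * x\<^sup>2)) * (- (4 * B\<^sup>2 * x)) * M + M' * exp (- (2 * B\<^sup>2 * x\<^sup>2)) \<le> 0"
      using mult_left_mono[of M' "4 * B\<^sup>2 * x * M" "exp (- (2 * B\<^sup>2 * x\<^sup>2))"]
      by (simp add: algebra_simps)
    ultimately show "\<exists>y. (g has_real_derivative y) (at x) \<and> y \<le> 0" by blast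
  qed
  then show ?thesis
    using card_perms[of n] by (simp add: g_def exp_minus field_simps)
qed

lemma perm_sum_mgf:
  fixes w v :: "nat \<Rightarrow> real"
  assumes w0: "(\<Sum>i=1..n. w i) = 0" and w1: "(\<Sum>i=1..n. (w i)\<^sup>2) = 1"
    and vB: "\<forall>i\<in>{1..n}. \<bar>v i\<bar> \<le> B" and n: "n > 0"
  shows "(\<Sum>\<pi>\<in>perms n. exp (t * perm_sum n w v \<pi>)) \<le> fact n * exp (2 * B\<^sup>2 * t\<^sup>2)"
proof (cases "t \<ge> 0")
  case True
  then show ?thesis using perm_sum_mgf_nonneg assms by blast
next
  case False
  have "perm_sum n (\<lambda>i. - w i) v \<pi> = - perm_sum n w v \<pi>" for \<pi>
    by (simp add: perm_sum_def sum_negf)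
  then show ?thesis
    using perm_sum_mgf_nonneg[of "\<lambda>i. - w i" n v B "- t"] assms False by (simp add: sum_negf)
qed

section \<open>Averages over disjoint pairs of positions\<close>

text \<open>Conditional uniformity without conditioning: since \<open>g\<close> ignores
  rearrangements of the positions in \<open>U\<close>, transpositions inside \<open>U\<close> carry
  \<open>(p, q)\<close> to any ordered pair of distinct positions there, and all these pairs can be
  averaged.\<close>

lemma sum_perms_pair_average:
  fixes g :: "(nat \<Rightarrow> nat) \<Rightarrow> real" and f :: "nat \<Rightarrow> nat \<Rightarrow> real"
  assumes U: "U \<subseteq> {1..n}" and p: "p \<in> U" and q: "q \<in> U" and pq: "p \<noteq> q"
    and g: "\<And>a b \<pi>. a \<in> U \<Longrightarrow> b \<in> U \<Longrightarrow> g (\<pi> \<circ> Transposition.transpose a b) = g \<pi>"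
  shows "real (card U) * (real (card U) - 1) * (\<Sum>\<pi>\<in>perms n. g \<pi> * f (\<pi> p) (\<pi> q))
       = (\<Sum>\<pi>\<in>perms n. g \<pi> * (\<Sum>c\<in>\<pi> ` U. \<Sum>d\<in>\<pi> ` U - {c}. f c d))"
proof -
  have fin: "finite U" using U finite_subset by blast
  have cardU: "card U \<ge> 1" using fin p by (auto simp: Suc_le_eq card_gt_0_iff)
  have move: "(\<Sum>\<pi>\<in>perms n. g \<pi> * f (\<pi> p) (\<pi> q)) = (\<Sum>\<pi>\<in>perms n. g \<pi> * f (\<pi> a) (\<pi> b))"
    if ab: "a \<in> U" "b \<in> U" "a \<noteq> b" for a b
  proof -
    \<comment> \<open>Moving \<open>p\<close> to \<open>a\<close> may displace \<open>q\<close> (if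
      \<open>q = a\<close>, it goes to \<open>p\<close>), so its new place is tracked; a second swap
      then takes it to \<open>b\<close> and fixes \<open>a\<close>.\<close>
    define q' where "q' = Transposition.transpose p a q"
    have q': "q' \<in> U" "q' \<noteq> a"
      using p q ab pq by (auto simp: q'_def Transposition.transpose_def)
    have "(\<Sum>\<pi>\<in>perms n. g \<pi> * f (\<pi> p) (\<pi> q)) = (\<Sum>\<pi>\<in>perms n. g \<pi> * f (\<pi> a) (\<pi> q'))"
      using sum_perms_transpose[of p n a "\<lambda>\<pi>. g \<pi> * f (\<pi> p) (\<pi> q)"] U p ab g[of p a]
      by (simp add: q'_def subset_iff)
    also have "\<dots> = (\<Sum>\<pi>\<in>perms n. g \<pi> * f (\<pi> a) (\<pi> b))"
    proof -
      have "Transposition.transpose q' b a = a" using q' ab by (intro transpose_apply_other) auto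
      then show ?thesis
        using sum_perms_transpose[of q' n b "\<lambda>\<pi>. g \<pi> * f (\<pi> a) (\<pi> q')"] U q' ab g[of q' b]
        by (simp add: subset_iff)
    qed
    finally show ?thesis .
  qed
  have img: "(\<Sum>c\<in>\<pi> ` U. \<Sum>d\<in>\<pi> ` U - {c}. f c d) = (\<Sum>a\<in>U. \<Sum>b\<in>U - {a}. f (\<pi> a) (\<pi> b))"
    if "\<pi> \<in> perms n" for \<pi>
  proof -
    have inj: "inj \<pi>" using that permutes_inj by auto
    have "\<pi> ` U - {\<pi> a} = \<pi> ` (U - {a})" for a
      using inj by (auto simp: inj_def)
    then show ?thesis
      using inj by (simp add: sum.reindex inj_on_subset[OF inj] o_def)
  qed
  have "(\<Sum>\<pi>\<in>perms n. g \<pi> * (\<Sum>c\<in>\<pi> ` U. \<Sum>d\<in>\<pi> ` U - {c}. f c d))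
      = (\<Sum>\<pi>\<in>perms n. \<Sum>a\<in>U. \<Sum>b\<in>U - {a}. g \<pi> * f (\<pi> a) (\<pi> b))"
    by (intro sum.cong refl) (simp add: img sum_distrib_left)
  also have "\<dots> = (\<Sum>a\<in>U. \<Sum>\<pi>\<in>perms n. \<Sum>b\<in>U - {a}. g \<pi> * f (\<pi> a) (\<pi> b))"
    by (rule sum.swap)
  also have "\<dots> = (\<Sum>a\<in>U. \<Sum>b\<in>U - {a}. \<Sum>\<pi>\<in>perms n. g \<pi> * f (\<pi> a) (\<pi> b))"
    by (intro sum.cong refl sum.swap)
  also have "\<dots> = (\<Sum>a\<in>U. \<Sum>b\<in>U - {a}. \<Sum>\<pi>\<in>perms n. g \<pi> * f (\<pi> p) (\<pi> q))"
    by (intro sum.cong refl move[symmetric]) auto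
  also have "\<dots> = real (card U) * (real (card U) - 1) * (\<Sum>\<pi>\<in>perms n. g \<pi> * f (\<pi> p) (\<pi> q))"
    using fin cardU by (simp add: card_Diff_singleton of_nat_diff)
  finally show ?thesis by simp
qed

text \<open>First moment method over random pairings: a random pair of distinct indices has mean
  squared weight gap \<open>2 / (n - 1)\<close>, so some choice of \<open>m\<close> disjoint pairs
  reaches \<open>2 m / n\<close>.\<close>

lemma ex_spread_pairs:
  fixes w :: "nat \<Rightarrow> real"
  assumes w0: "(\<Sum>i=1..n. w i) = 0" and w1: "(\<Sum>i=1..n. (w i)\<^sup>2) = 1"
    and m: "2 * m \<le> n" and n: "n \<ge> 2"
  obtains e where "inj_on e {..<2 * m}" "e ` {..<2 * m} \<subseteq> {1..n}"
    "(\<Sum>k<m. (w (e (2 * k)) - w (e (2 * k + 1)))\<^sup>2) \<ge> 2 * real m / real n"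
proof -
  define D where "D = (\<lambda>\<pi>::nat\<Rightarrow>nat. \<Sum>k<m. (w (\<pi> (2 * k + 1)) - w (\<pi> (2 * k + 2)))\<^sup>2)"
  have tot: "(\<Sum>c\<in>{1..n}. \<Sum>d\<in>{1..n} - {c}. (w c - w d)\<^sup>2) = 2 * real n"
  proof -
    have "(\<Sum>c\<in>{1..n}. \<Sum>d\<in>{1..n} - {c}. (w c - w d)\<^sup>2)
        = (\<Sum>c=1..n. \<Sum>d=1..n. (w c - w d) * (w c - w d))"
      by (intro sum.cong refl sum.mono_neutral_cong_left) (auto simp: power2_eq_square)
    also have "\<dots> = 2 * real n * (\<Sum>i=1..n. w i * w i)" by (rule sum_diff_products[OF w0])
    finally show ?thesis using w1 by (simp add: power2_eq_square)
  qed
  have one: "real n * (real n - 1) *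
      (\<Sum>\<pi>\<in>perms n. (w (\<pi> (2 * k + 1)) - w (\<pi> (2 * k + 2)))\<^sup>2) = fact n * (2 * real n)"
    if "k < m" for k
  proof -
    have "real n * (real n - 1) *
        (\<Sum>\<pi>\<in>perms n. (w (\<pi> (2 * k + 1)) - w (\<pi> (2 * k + 2)))\<^sup>2)
      = (\<Sum>\<pi>\<in>perms n. \<Sum>c\<in>\<pi> ` {1..n}. \<Sum>d\<in>\<pi> ` {1..n} - {c}. (w c - w d)\<^sup>2)"
      using sum_perms_pair_average[of "{1..n}" n "2 * k + 1" "2 * k + 2" "\<lambda>_. 1"
          "\<lambda>c d. (w c - w d)\<^sup>2"] m that by simp
    also have "\<dots> = (\<Sum>\<pi>\<in>perms n. 2 * real n)"
      using permutes_image[of _ "{1..n}"] tot by (intro sum.cong) auto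
    finally show ?thesis using card_perms[of n] by simp
  qed
  have "real n * (real n - 1) * (\<Sum>\<pi>\<in>perms n. D \<pi>) = real m * (fact n * (2 * real n))"
  proof -
    have "(\<Sum>\<pi>\<in>perms n. D \<pi>)
        = (\<Sum>k<m. \<Sum>\<pi>\<in>perms n. (w (\<pi> (2 * k + 1)) - w (\<pi> (2 * k + 2)))\<^sup>2)"
      unfolding D_def by (rule sum.swap)
    then show ?thesis using one by (simp add: sum_distrib_left)
  qed
  then have "real n * ((real n - 1) * (\<Sum>\<pi>\<in>perms n. D \<pi>)) = real n * (2 * real m * fact n)"
    by (simp only: mult_ac)
  then have sumD: "(real n - 1) * (\<Sum>\<pi>\<in>perms n. D \<pi>) = 2 * real m * fact n"
    using n by simp
  have "\<exists>\<pi>\<in>perms n. D \<pi> \<ge> 2 * real m / real n"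
  proof (rule ccontr)
    assume "\<not> ?thesis"
    then have "(\<Sum>\<pi>\<in>perms n. D \<pi>) < (\<Sum>\<pi>\<in>perms n. 2 * real m / real n)"
      using finite_perms perms_nonempty by (intro sum_strict_mono) auto
    then have "(\<Sum>\<pi>\<in>perms n. D \<pi>) < fact n * (2 * real m / real n)"
      using card_perms[of n] by simp
    then have "(real n - 1) * (\<Sum>\<pi>\<in>perms n. D \<pi>) < (real n - 1) * (fact n * (2 * real m / real n))"
      using n by (intro mult_strict_left_mono) auto
    also have "\<dots> \<le> real n * (fact n * (2 * real m / real n))"
      by (intro mult_right_mono) auto
    also have "\<dots> = 2 * real m * fact n" using n by simp
    finally show False using sumD by simp
  qed
  then obtain \<pi> where \<pi>: "\<pi> permutes {1..n}" "D \<pi> \<ge> 2 * real m / real n" by blast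
  show thesis
  \<comment> \<open>The shift reconciles the index set \<open>{..<2 * m}\<close> of
    \<open>e\<close>, which starts at 0, with positions starting at 1.\<close>
  proof (rule that[of "\<lambda>i. \<pi> (i + 1)"])
    show "inj_on (\<lambda>i. \<pi> (i + 1)) {..<2 * m}"
    proof (rule inj_onI)
      fix x y assume "\<pi> (x + 1) = \<pi> (y + 1)"
      then have "x + 1 = y + 1" by (rule injD[OF permutes_inj[OF \<pi>(1)]])
      then show "x = y" by simp
    qed
    show "(\<lambda>i. \<pi> (i + 1)) ` {..<2 * m} \<subseteq> {1..n}"
    proof
      fix x assume "x \<in> (\<lambda>i. \<pi> (i + 1)) ` {..<2 * m}"
      then obtain i where "i < 2 * m" "x = \<pi> (i + 1)" by auto
      moreover have "i + 1 \<in> {1..n}" using \<open>i < 2 * m\<close> m by auto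
      ultimately show "x \<in> {1..n}" using permutes_in_image[OF \<pi>(1)] by blast
    qed
    show "2 * real m / real n \<le> (\<Sum>k<m. (w (\<pi> (2 * k + 1)) - w (\<pi> (2 * k + 1 + 1)))\<^sup>2)"
      using \<pi>(2) by (simp add: D_def)
  qed
qed

text \<open>The images of the pairs are revealed one after the other; given the first \<open>k\<close> pairs, the next
  one is uniform on the ordered pairs of remaining values.\<close>

lemma sum_perms_prod_le:
  fixes f :: "nat \<Rightarrow> nat \<Rightarrow> nat \<Rightarrow> real" and r :: "nat \<Rightarrow> real"
  assumes inj: "inj_on e {..<2 * m}" and img: "e ` {..<2 * m} \<subseteq> {1..n}"
    and f0: "\<And>k c d. f k c d \<ge> 0" and r0: "\<And>k. k < m \<Longrightarrow> r k \<ge> 0"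
    and step: "\<And>k V. k < m \<Longrightarrow> V \<subseteq> {1..n} \<Longrightarrow> card V = n - 2 * k \<Longrightarrow>
      (\<Sum>c\<in>V. \<Sum>d\<in>V - {c}. f k c d) \<le> real (card V) * (real (card V) - 1) * r k"
    and "j \<le> m"
  shows "(\<Sum>\<pi>\<in>perms n. \<Prod>k<j. f k (\<pi> (e (2 * k))) (\<pi> (e (2 * k + 1)))) \<le> fact n * (\<Prod>k<j. r k)"
  using \<open>j \<le> m\<close>
proof (induction j)
  case 0
  then show ?case using card_perms[of n] by simp
next
  case (Suc j)
  define g where "g = (\<lambda>\<pi>. \<Prod>k<j. f k (\<pi> (e (2 * k))) (\<pi> (e (2 * k + 1))))"
  define U where "U = {1..n} - e ` {..<2 * j}"
  have sub: "{..<2 * j} \<subseteq> {..<2 * m}" using Suc.prems by auto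
  have cm: "2 * m \<le> n"
    using card_mono[OF _ img] card_image[OF inj] by simp
  have "card (e ` {..<2 * j}) = 2 * j"
    using card_image[OF inj_on_subset[OF inj sub]] by simp
  moreover have "e ` {..<2 * j} \<subseteq> {1..n}"
    using img image_mono[OF sub] by (meson subset_trans)
  ultimately have cardU: "card U = n - 2 * j"
    using card_Diff_subset[of "e ` {..<2 * j}" "{1..n}"] by (simp add: U_def)
  have notin: "e i \<in> U" if "2 * j \<le> i" "i < 2 * m" for i
  proof -
    have "e i \<notin> e ` {..<2 * j}"
    proof
      assume "e i \<in> e ` {..<2 * j}"
      then obtain i' where "i' < 2 * j" "e i = e i'" by auto
      with that inj have "i = i'" by (auto simp: inj_on_def)
      with \<open>i' < 2 * j\<close> that show False by simp
    qed
    then show ?thesis using img that by (auto simp: U_def)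
  qed
  have pU: "e (2 * j) \<in> U" "e (2 * j + 1) \<in> U" using notin Suc.prems by auto
  have pq: "e (2 * j) \<noteq> e (2 * j + 1)"
    using inj_onD[OF inj, of "2 * j" "2 * j + 1"] Suc.prems by auto
  \<comment> \<open>The factors already revealed only look at positions outside
    \<open>U\<close>.\<close>
  have g_inv: "g (\<pi> \<circ> Transposition.transpose a b) = g \<pi>" if "a \<in> U" "b \<in> U" for a b \<pi>
    unfolding g_def
  proof (intro prod.cong refl)
    fix k assume k: "k \<in> {..<j}"
    have "e i \<noteq> a \<and> e i \<noteq> b" if "i < 2 * j" for i
      using that \<open>a \<in> U\<close> \<open>b \<in> U\<close> by (auto simp: U_def)
    moreover have "2 * k < 2 * j" "2 * k + 1 < 2 * j" using k by auto
    ultimately have "Transposition.transpose a b (e (2 * k)) = e (2 * k)"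
      "Transposition.transpose a b (e (2 * k + 1)) = e (2 * k + 1)"
      by (metis transpose_apply_other)+
    then show "f k ((\<pi> \<circ> Transposition.transpose a b) (e (2 * k))) ((\<pi> \<circ> Transposition.transpose a b) (e (2 * k + 1)))
        = f k (\<pi> (e (2 * k))) (\<pi> (e (2 * k + 1)))" by simp
  qed
  let ?N = "real (card U) * (real (card U) - 1)"
  \<comment> \<open>As \<open>j < m\<close> and \<open>2 * m \<le> n\<close>, at least two positions
    remain, so the number of ordered pairs can be cancelled.\<close>
  have Npos: "?N > 0" using cardU cm Suc.prems by (intro mult_pos_pos) auto
  have U: "U \<subseteq> {1..n}" by (simp add: U_def)
  have "?N * (\<Sum>\<pi>\<in>perms n. g \<pi> * f j (\<pi> (e (2 * j))) (\<pi> (e (2 * j + 1))))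
      = (\<Sum>\<pi>\<in>perms n. g \<pi> * (\<Sum>c\<in>\<pi> ` U. \<Sum>d\<in>\<pi> ` U - {c}. f j c d))"
    using U pU pq g_inv by (rule sum_perms_pair_average)
  also have "\<dots> \<le> (\<Sum>\<pi>\<in>perms n. g \<pi> * (?N * r j))"
  proof (intro sum_mono mult_left_mono)
    fix \<pi> assume "\<pi> \<in> perms n"
    then have \<pi>: "\<pi> permutes {1..n}" by simp
    have "card (\<pi> ` U) = card U"
      using permutes_inj[OF \<pi>] by (meson card_image inj_on_subset subset_UNIV)
    moreover have "\<pi> ` U \<subseteq> {1..n}" using U permutes_image[OF \<pi>] by blast
    ultimately show "(\<Sum>c\<in>\<pi> ` U. \<Sum>d\<in>\<pi> ` U - {c}. f j c d) \<le> ?N * r j"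
      using step[of j "\<pi> ` U"] Suc.prems cardU by simp
    show "g \<pi> \<ge> 0" unfolding g_def using f0 by (simp add: prod_nonneg)
  qed
  also have "\<dots> = ?N * (r j * (\<Sum>\<pi>\<in>perms n. g \<pi>))"
    by (simp add: sum_distrib_left sum_distrib_right mult_ac)
  finally have "(\<Sum>\<pi>\<in>perms n. g \<pi> * f j (\<pi> (e (2 * j))) (\<pi> (e (2 * j + 1))))
      \<le> r j * (\<Sum>\<pi>\<in>perms n. g \<pi>)"
    using Npos by (simp only: mult_le_cancel_left_pos)
  also have "\<dots> \<le> r j * (fact n * (\<Prod>k<j. r k))"
    unfolding g_def using Suc r0 by (intro mult_left_mono) auto
  finally show ?case by (simp add: g_def mult_ac)
qed

section \<open>Random signs from swapping pairs\<close>

text \<open>Halved because swapping the pair changes the permutation sum by twice this amount: the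
  two values are a common centre plus and minus the gap, a Rademacher term.\<close>

definition pair_gap :: "(nat \<Rightarrow> nat) \<Rightarrow> (nat \<Rightarrow> real) \<Rightarrow> (nat \<Rightarrow> real) \<Rightarrow> nat \<Rightarrow> (nat \<Rightarrow> nat) \<Rightarrow> real"
  where "pair_gap e w v k \<pi> =
    (w (e (2 * k)) - w (e (2 * k + 1))) * (v (\<pi> (e (2 * k))) - v (\<pi> (e (2 * k + 1)))) / 2"

text \<open>Averaging over the transpositions of the pairs turns each pair into a random sign.\<close>

lemma sum_exp_eq_sum_prod_cosh:
  fixes z :: "'a::{real_normed_field,banach}"
  assumes inj: "inj_on e {..<2 * m}" and img: "e ` {..<2 * m} \<subseteq> {1..n}" and "j \<le> m"
  shows "(\<Sum>\<pi>\<in>perms n. exp (z * of_real (perm_sum n w v \<pi>))) =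
    (\<Sum>\<pi>\<in>perms n. exp (z * of_real (perm_sum n w v \<pi> - (\<Sum>k<j. pair_gap e w v k \<pi>))) *
      (\<Prod>k<j. cosh (z * of_real (pair_gap e w v k \<pi>))))"
  using \<open>j \<le> m\<close>
proof (induction j)
  case 0
  then show ?case by simp
next
  case (Suc j)
  let ?y = "pair_gap e w v"
  define X where "X = (\<lambda>\<pi>. perm_sum n w v \<pi> - (\<Sum>k<j. ?y k \<pi>))"
  define C where "C = (\<lambda>\<pi>. \<Prod>k<j. cosh (z * of_real (?y k \<pi>)))"
  let ?\<tau> = "Transposition.transpose (e (2 * j)) (e (2 * j + 1))"
  have mem: "e (2 * j) \<in> {1..n}" "e (2 * j + 1) \<in> {1..n}"
    using img Suc.prems by (auto simp: image_subset_iff)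
  have y_other: "?y k (\<pi> \<circ> ?\<tau>) = ?y k \<pi>" if "k < j" for k \<pi>
  proof -
    have "e (2 * k) \<noteq> e (2 * j)" "e (2 * k) \<noteq> e (2 * j + 1)"
      "e (2 * k + 1) \<noteq> e (2 * j)" "e (2 * k + 1) \<noteq> e (2 * j + 1)"
      using that Suc.prems by (auto simp: inj_on_eq_iff[OF inj])
    then have "?\<tau> (e (2 * k)) = e (2 * k)" "?\<tau> (e (2 * k + 1)) = e (2 * k + 1)"
      by (metis transpose_apply_other)+
    then show ?thesis by (simp add: pair_gap_def)
  qed
  have S_swap: "perm_sum n w v (\<pi> \<circ> ?\<tau>) = perm_sum n w v \<pi> - 2 * ?y j \<pi>" for \<pi>
    by (simp only: perm_sum_transpose[OF mem]) (simp add: pair_gap_def)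
  have X_swap: "X (\<pi> \<circ> ?\<tau>) = X \<pi> - 2 * ?y j \<pi>" for \<pi>
  proof -
    have "(\<Sum>k<j. ?y k (\<pi> \<circ> ?\<tau>)) = (\<Sum>k<j. ?y k \<pi>)"
      by (intro sum.cong refl y_other) simp
    then show ?thesis by (simp only: X_def S_swap)
  qed
  have C_swap: "C (\<pi> \<circ> ?\<tau>) = C \<pi>" for \<pi>
    unfolding C_def by (intro prod.cong refl) (simp only: y_other lessThan_iff)
  \<comment> \<open>Averaging \<open>\<pi>\<close> with its swapped version: \<open>X\<close> and
    \<open>X - 2 y\<close> have midpoint \<open>X - y\<close>, and the two exponentials combine to
    \<open>2 cosh\<close> of the gap.\<close>
  have "2 * (\<Sum>\<pi>\<in>perms n. exp (z * of_real (X \<pi>)) * C \<pi>) =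
      (\<Sum>\<pi>\<in>perms n. exp (z * of_real (X \<pi>)) * C \<pi>) +
      (\<Sum>\<pi>\<in>perms n. exp (z * of_real (X (\<pi> \<circ> ?\<tau>))) * C (\<pi> \<circ> ?\<tau>))"
    by (subst sum_perms_transpose[OF mem, of "\<lambda>\<pi>. exp (z * of_real (X \<pi>)) * C \<pi>"]) (rule mult_2)
  also have "\<dots> = (\<Sum>\<pi>\<in>perms n.
      (exp (z * of_real (X \<pi>)) + exp (z * of_real (X \<pi> - 2 * ?y j \<pi>))) * C \<pi>)"
    by (simp only: X_swap C_swap sum.distrib distrib_right)
  also have "\<dots> = (\<Sum>\<pi>\<in>perms n.
      2 * (exp (z * of_real (X \<pi> - ?y j \<pi>)) * (C \<pi> * cosh (z * of_real (?y j \<pi>)))))"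
  proof (intro sum.cong refl)
    fix \<pi>
    have "exp (z * of_real (X \<pi>)) = exp (z * of_real (X \<pi> - ?y j \<pi>)) * exp (z * of_real (?y j \<pi>))"
      by (simp add: algebra_simps flip: exp_add)
    moreover have "exp (z * of_real (X \<pi> - 2 * ?y j \<pi>))
        = exp (z * of_real (X \<pi> - ?y j \<pi>)) * exp (- (z * of_real (?y j \<pi>)))"
      by (simp add: algebra_simps flip: exp_add)
    ultimately show "(exp (z * of_real (X \<pi>)) + exp (z * of_real (X \<pi> - 2 * ?y j \<pi>))) * C \<pi> =
        2 * (exp (z * of_real (X \<pi> - ?y j \<pi>)) * (C \<pi> * cosh (z * of_real (?y j \<pi>))))"
      by (simp add: cosh_field_def algebra_simps)
  qed
  also have "\<dots> = 2 * (\<Sum>\<pi>\<in>perms n.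
      exp (z * of_real (X \<pi> - ?y j \<pi>)) * (C \<pi> * cosh (z * of_real (?y j \<pi>))))"
    by (simp only: sum_distrib_left)
  finally have "(\<Sum>\<pi>\<in>perms n. exp (z * of_real (X \<pi>)) * C \<pi>) = (\<Sum>\<pi>\<in>perms n.
      exp (z * of_real (X \<pi> - ?y j \<pi>)) * (C \<pi> * cosh (z * of_real (?y j \<pi>))))"
    by simp
  moreover have "(\<Sum>\<pi>\<in>perms n. exp (z * of_real (perm_sum n w v \<pi>)))
      = (\<Sum>\<pi>\<in>perms n. exp (z * of_real (X \<pi>)) * C \<pi>)"
    using Suc unfolding X_def C_def by simp
  moreover have "X \<pi> - ?y j \<pi> = perm_sum n w v \<pi> - (\<Sum>k<Suc j. ?y k \<pi>)" for \<pi>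
    by (simp add: X_def)
  moreover have "C \<pi> * cosh (z * of_real (?y j \<pi>))
      = (\<Prod>k<Suc j. cosh (z * of_real (?y k \<pi>)))" for \<pi>
    by (simp add: C_def)
  ultimately show ?case by simp
qed

lemma cosh_le_2:
  fixes a :: real
  assumes "\<bar>a\<bar> \<le> 1"
  shows "cosh a \<le> 2"
proof -
  have "cosh a \<le> cosh (1::real)"
    using assms cosh_real_nonneg_le_iff[of "\<bar>a\<bar>" 1] by simp
  also have "\<dots> \<le> 2" using exp_le exp_le_one_iff[of "- 1 :: real"] by (simp add: cosh_field_def del: exp_le_one_iff)
  finally show ?thesis .
qed

text \<open>The squared modulus is exactly \<open>(cosh a)\<^sup>2 - (sin b)\<^sup>2\<close>.
  Restricting to \<open>\<bar>a\<bar> \<le> 1\<close> gives \<open>cosh a \<le> 2\<close>, so the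
  loss \<open>(sin b)\<^sup>2\<close> is a fixed proportion of \<open>(cosh a)\<^sup>2\<close> times
  \<open>(sin b)\<^sup>2\<close>.\<close>

lemma norm_cosh_Complex_le:
  assumes "\<bar>a\<bar> \<le> 1"
  shows "norm (cosh (Complex a b)) \<le> cosh a * exp (- (sin b)\<^sup>2 / 8)"
proof (rule power2_le_imp_le)
  have "Re (cosh (Complex a b)) = cosh a * cos b" "Im (cosh (Complex a b)) = sinh a * sin b"
    by (simp_all add: cosh_field_def sinh_field_def Re_exp Im_exp algebra_simps)
  then have "(norm (cosh (Complex a b)))\<^sup>2 = (cosh a)\<^sup>2 * (cos b)\<^sup>2 + (sinh a)\<^sup>2 * (sin b)\<^sup>2"
    by (simp add: cmod_power2 power_mult_distrib)
  also have "\<dots> = (cosh a)\<^sup>2 - (sin b)\<^sup>2"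
    by (simp add: sinh_square_eq cos_squared_eq algebra_simps)
  also have "\<dots> \<le> (cosh a)\<^sup>2 * (1 - (sin b)\<^sup>2 / 4)"
  proof -
    have "(cosh a)\<^sup>2 \<le> 2\<^sup>2" using cosh_le_2[OF assms] by (intro power_mono) auto
    then have "(cosh a)\<^sup>2 * (sin b)\<^sup>2 \<le> 4 * (sin b)\<^sup>2" by (intro mult_right_mono) auto
    then show ?thesis by (simp add: algebra_simps)
  qed
  also have "\<dots> \<le> (cosh a)\<^sup>2 * exp (- (sin b)\<^sup>2 / 4)"
    using exp_ge_add_one_self[of "- (sin b)\<^sup>2 / 4"] by (intro mult_left_mono) auto
  also have "\<dots> = (cosh a * exp (- (sin b)\<^sup>2 / 8))\<^sup>2"
    by (simp add: power_mult_distrib flip: exp_double)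
  finally show "(norm (cosh (Complex a b)))\<^sup>2 \<le> (cosh a * exp (- (sin b)\<^sup>2 / 8))\<^sup>2" .
qed simp

text \<open>Cauchy--Schwarz separates the exponential tilt \<open>s\<close> from the oscillation in \<open>\<theta>\<close>
  without loss, because \<open>cosh\<^sup>2 x \<le> cosh (2 x)\<close>.\<close>

lemma norm_sum_exp_le:
  assumes inj: "inj_on e {..<2 * m}" and img: "e ` {..<2 * m} \<subseteq> {1..n}"
    and small: "\<And>k \<pi>. k < m \<Longrightarrow> \<pi> \<in> perms n \<Longrightarrow> \<bar>s * pair_gap e w v k \<pi>\<bar> \<le> 1"
  shows "norm (\<Sum>\<pi>\<in>perms n. exp (Complex s \<theta> * of_real (perm_sum n w v \<pi>)))
    \<le> sqrt (\<Sum>\<pi>\<in>perms n. exp (2 * s * perm_sum n w v \<pi>)) *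
      sqrt (\<Sum>\<pi>\<in>perms n. \<Prod>k<m. exp (- (sin (\<theta> * pair_gap e w v k \<pi>))\<^sup>2 / 4))"
proof -
  let ?y = "pair_gap e w v"
  define X where "X = (\<lambda>\<pi>. perm_sum n w v \<pi> - (\<Sum>k<m. ?y k \<pi>))"
  define a where "a = (\<lambda>\<pi>. exp (s * X \<pi>) * (\<Prod>k<m. cosh (s * ?y k \<pi>)))"
  define b where "b = (\<lambda>\<pi>. \<Prod>k<m. exp (- (sin (\<theta> * ?y k \<pi>))\<^sup>2 / 8))"
  have "norm (\<Sum>\<pi>\<in>perms n. exp (Complex s \<theta> * of_real (perm_sum n w v \<pi>)))
     = norm (\<Sum>\<pi>\<in>perms n. exp (Complex s \<theta> * of_real (X \<pi>)) *
        (\<Prod>k<m. cosh (Complex s \<theta> * of_real (?y k \<pi>))))"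
    unfolding X_def by (subst sum_exp_eq_sum_prod_cosh[OF inj img order.refl]) (rule refl)
  also have "\<dots> \<le> (\<Sum>\<pi>\<in>perms n. a \<pi> * b \<pi>)"
  proof (rule sum_norm_le)
    fix \<pi> assume \<pi>: "\<pi> \<in> perms n"
    have "Complex s \<theta> * of_real r = Complex (s * r) (\<theta> * r)" for r
      by (simp add: complex_eq_iff)
    then have "norm (exp (Complex s \<theta> * of_real (X \<pi>)) *
        (\<Prod>k<m. cosh (Complex s \<theta> * of_real (?y k \<pi>))))
      = exp (s * X \<pi>) * (\<Prod>k<m. norm (cosh (Complex (s * ?y k \<pi>) (\<theta> * ?y k \<pi>))))"
      by (simp add: norm_mult prod_norm)
    also have "\<dots> \<le> exp (s * X \<pi>) *
        (\<Prod>k<m. cosh (s * ?y k \<pi>) * exp (- (sin (\<theta> * ?y k \<pi>))\<^sup>2 / 8))"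
      using \<pi> by (intro mult_left_mono prod_mono conjI norm_cosh_Complex_le small) auto
    also have "\<dots> = a \<pi> * b \<pi>" by (simp add: a_def b_def prod.distrib)
    finally show "norm (exp (Complex s \<theta> * of_real (X \<pi>)) *
        (\<Prod>k<m. cosh (Complex s \<theta> * of_real (?y k \<pi>)))) \<le> a \<pi> * b \<pi>" .
  qed
  also have "\<dots> \<le> sqrt ((\<Sum>\<pi>\<in>perms n. (a \<pi>)\<^sup>2) * (\<Sum>\<pi>\<in>perms n. (b \<pi>)\<^sup>2))"
    by (rule real_le_rsqrt, rule Cauchy_Schwarz_ineq_sum)
  also have "\<dots> = sqrt (\<Sum>\<pi>\<in>perms n. (a \<pi>)\<^sup>2) * sqrt (\<Sum>\<pi>\<in>perms n. (b \<pi>)\<^sup>2)"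
    by (rule real_sqrt_mult)
  also have "\<dots> \<le> sqrt (\<Sum>\<pi>\<in>perms n. exp (2 * s * perm_sum n w v \<pi>)) *
      sqrt (\<Sum>\<pi>\<in>perms n. (b \<pi>)\<^sup>2)"
  proof (intro mult_right_mono real_sqrt_le_mono)
    have "(\<Sum>\<pi>\<in>perms n. (a \<pi>)\<^sup>2)
        \<le> (\<Sum>\<pi>\<in>perms n. exp (2 * s * X \<pi>) * (\<Prod>k<m. cosh (2 * s * ?y k \<pi>)))"
    proof (rule sum_mono)
      fix \<pi>
      have "(a \<pi>)\<^sup>2 = exp (2 * s * X \<pi>) * (\<Prod>k<m. (cosh (s * ?y k \<pi>))\<^sup>2)"
        by (simp add: a_def power_mult_distrib prod_power_distrib mult.assoc flip: exp_double)
      also have "\<dots> \<le> exp (2 * s * X \<pi>) * (\<Prod>k<m. cosh (2 * s * ?y k \<pi>))"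
        by (intro mult_left_mono prod_mono) (auto simp: cosh_double mult.assoc)
      finally show "(a \<pi>)\<^sup>2 \<le> exp (2 * s * X \<pi>) * (\<Prod>k<m. cosh (2 * s * ?y k \<pi>))" .
    qed
    \<comment> \<open>The sign-averaging identity read backwards at the real argument
      \<open>2 * s\<close>; this reuse is why it is stated for a general field.\<close>
    also have "\<dots> = (\<Sum>\<pi>\<in>perms n. exp (2 * s * perm_sum n w v \<pi>))"
      using sum_exp_eq_sum_prod_cosh[OF inj img order.refl, of "2 * s" w v]
      by (simp add: X_def)
    finally show "(\<Sum>\<pi>\<in>perms n. (a \<pi>)\<^sup>2) \<le> (\<Sum>\<pi>\<in>perms n. exp (2 * s * perm_sum n w v \<pi>))" .
  qed (simp add: sum_nonneg)
  also have "(\<Sum>\<pi>\<in>perms n. (b \<pi>)\<^sup>2)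
      = (\<Sum>\<pi>\<in>perms n. \<Prod>k<m. exp (- (sin (\<theta> * ?y k \<pi>))\<^sup>2 / 4))"
    by (simp add: b_def prod_power_distrib flip: exp_double)
  finally show ?thesis .
qed

section \<open>Sparsity of resonances along an arithmetic progression\<close>

lemma sin_ge_jordan:
  assumes "0 \<le> x" "x \<le> pi / 2"
  shows "2 / pi * x \<le> sin x"
proof -
  have "concave_on {0..pi / 2} sin"
    by (rule f''_le0_imp_concave[where f' = cos and f'' = "\<lambda>x. - sin x"])
      (auto intro!: derivative_eq_intros sin_ge_zero)
  then have "(1 - 2 / pi * x) * sin 0 + 2 / pi * x * sin (pi / 2)
      \<le> sin ((1 - 2 / pi * x) *\<^sub>R 0 + (2 / pi * x) *\<^sub>R (pi / 2))"
    by (rule concave_onD) (use assms in \<open>auto simp: field_simps\<close>)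
  then show ?thesis by simp
qed

text \<open>A packing bound: the translates of \<open>D\<close> by
  \<open>0, h, ..., (R - 1) h\<close> are pairwise disjoint and all fit into
  \<open>{1..n + R * h}\<close>.\<close>

lemma card_le_of_disjoint_shifts:
  assumes D: "D \<subseteq> {1..n}"
    and disj: "\<And>j d d'. 1 \<le> j \<Longrightarrow> j < R \<Longrightarrow> d \<in> D \<Longrightarrow> d' \<in> D \<Longrightarrow> d \<noteq> d' + j * h"
  shows "R * card D \<le> n + R * h"
proof -
  let ?f = "\<lambda>(j, d). d + j * h"
  have lt: False if "j < j'" "j' < R" "d \<in> D" "d' \<in> D" "d + j * h = d' + j' * h" for j j' d d'
  proof -
    have "j' * h = (j' - j) * h + j * h" using that(1) by (simp flip: add_mult_distrib)
    then have "d = d' + (j' - j) * h" using that(5) by simp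
    then show False using disj[of "j' - j" d d'] that by simp
  qed
  have "inj_on ?f ({..<R} \<times> D)"
  proof (rule inj_onI, clarify)
    fix j d j' d'
    assume *: "j < R" "d \<in> D" "j' < R" "d' \<in> D" "d + j * h = d' + j' * h"
    then have "\<not> j < j'" "\<not> j' < j" using lt[of j j' d d'] lt[of j' j d' d] by auto
    then show "j = j' \<and> d = d'" using * by simp
  qed
  moreover have "?f ` ({..<R} \<times> D) \<subseteq> {1..n + R * h}"
  proof clarify
    fix j d assume *: "j < R" "d \<in> D"
    then have "1 \<le> d" "d \<le> n" "j * h \<le> R * h" using D by (auto intro: mult_right_mono)
    then have "1 \<le> d + j * h" "d + j * h \<le> n + R * h" by linarith+
    then show "d + j * h \<in> {1..n + R * h}" by (simp only: atLeastAtMost_iff)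
  qed
  ultimately have "card ({..<R} \<times> D) \<le> card {1..n + R * h}"
    by (intro card_inj_on_le) auto
  then show ?thesis by (simp add: card_cartesian_product)
qed

text \<open>Supplies the packing step. All multiples \<open>j h\<close> with
  \<open>1 \<le> j < R\<close> must keep \<open>\<bar>y\<bar> j h\<close> within
  \<open>(0, pi / 2]\<close>, where the sine is at least its chord. This holds with \<open>h\<close>
  either as long as the packing allows or proportional to \<open>1 / \<bar>y\<bar>\<close>.\<close>

lemma ex_shift:
  fixes y \<delta> :: real
  assumes \<delta>: "0 < \<delta>" "\<delta> \<le> 1" and n: "real n \<ge> 8 / \<delta>" and y: "\<bar>y\<bar> \<le> pi * \<delta> / 32"
  shows "\<exists>h R::nat. real R \<ge> 8 / \<delta> \<and> real h \<le> \<delta> * n / 8 \<and>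
    (\<forall>j. 1 \<le> j \<longrightarrow> j < R \<longrightarrow> \<delta> / 32 * min 1 (\<bar>y\<bar> * n) \<le> \<bar>sin (y * (real j * real h))\<bar>)"
proof -
  \<comment> \<open>Chosen so that \<open>n / R \<le> \<delta> n / 8\<close>; rounding up is
    harmless because only \<open>j < R\<close> occurs, which still gives
    \<open>j \<le> 8 / \<delta>\<close>.\<close>
  define R where "R = nat \<lceil>8 / \<delta>\<rceil>"
  have R: "real R \<ge> 8 / \<delta>" unfolding R_def by (simp add: real_nat_ceiling_ge)
  have jR: "real j \<le> 8 / \<delta>" if "j < R" for j
    using that unfolding R_def by linarith
  have dn: "\<delta> * n \<ge> 8" using n \<delta> by (simp add: field_simps)
  have abs_sin: "\<bar>sin (y * (real j * real h))\<bar> = \<bar>sin (\<bar>y\<bar> * (real j * real h))\<bar>" for j h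
    by (cases "y \<ge> 0") auto
  have sin_low: "2 / pi * (\<bar>y\<bar> * h) \<le> \<bar>sin (y * (real j * real h))\<bar>"
    if j: "1 \<le> j" and up: "\<bar>y\<bar> * (real j * real h) \<le> pi / 2" for j h :: nat
  proof -
    have "1 * real h \<le> real j * real h" using j by (intro mult_right_mono) auto
    then have "2 / pi * (\<bar>y\<bar> * h) \<le> 2 / pi * (\<bar>y\<bar> * (real j * real h))"
      by (intro mult_left_mono) auto
    also have "\<dots> \<le> sin (\<bar>y\<bar> * (real j * real h))"
      by (rule sin_ge_jordan[OF _ up]) simp
    finally show ?thesis unfolding abs_sin by linarith
  qed
  show ?thesis
  proof (cases "\<bar>y\<bar> * n \<le> pi / 2")
    case True
    \<comment> \<open>Slow oscillation: \<open>y\<close> completes at most a quarter period over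
      length \<open>n\<close>, so the longest permitted shift works. Rounding down a number that is
      at least 1 loses at most a factor 2.\<close>
    define h where "h = nat \<lfloor>\<delta> * n / 8\<rfloor>"
    have h: "real h \<le> \<delta> * n / 8" "real h \<ge> \<delta> * n / 16"
    proof -
      have "\<lfloor>\<delta> * n / 8\<rfloor> \<ge> 1" using dn by (simp add: le_floor_iff)
      then show "real h \<le> \<delta> * n / 8" "real h \<ge> \<delta> * n / 16"
        unfolding h_def by linarith+
    qed
    have "\<delta> / 32 * min 1 (\<bar>y\<bar> * n) \<le> \<bar>sin (y * (real j * real h))\<bar>" if j: "1 \<le> j" "j < R" for j
    proof -
      have "real j * real h \<le> 8 / \<delta> * (\<delta> * n / 8)"
        using jR[OF j(2)] h \<delta> by (intro mult_mono) auto
      then have "real j * real h \<le> n" using \<delta> by simp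
      then have "\<bar>y\<bar> * (real j * real h) \<le> \<bar>y\<bar> * n" by (rule mult_left_mono) simp
      then have *: "2 / pi * (\<bar>y\<bar> * h) \<le> \<bar>sin (y * (real j * real h))\<bar>"
        using True by (intro sin_low j) linarith
      have "\<delta> / 32 * min 1 (\<bar>y\<bar> * n) \<le> \<delta> / 32 * (\<bar>y\<bar> * n)"
        using \<delta> by (intro mult_left_mono) auto
      also have "\<dots> = 2 / 4 * (\<bar>y\<bar> * (\<delta> * n / 16))" by simp
      also have "\<dots> \<le> 2 / pi * (\<bar>y\<bar> * h)"
        using h pi_less_4 \<delta> by (intro mult_mono divide_left_mono mult_left_mono) auto
      finally show ?thesis using * by linarith
    qed
    then show ?thesis using R h by blast
  next
    case False
    have y0: "\<bar>y\<bar> > 0" using False by auto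
    \<comment> \<open>Fast oscillation: \<open>\<bar>y\<bar> h\<close> is placed between
      \<open>\<alpha>\<close> and \<open>2 \<alpha>\<close>, so that \<open>8 / \<delta>\<close>
      multiples end at \<open>pi / 2\<close> at most. The hypothesis
      \<open>\<bar>y\<bar> \<le> \<alpha>\<close> makes rounding up cost at most a factor 2.\<close>
    define \<alpha> where "\<alpha> = pi * \<delta> / 32"
    define h where "h = nat \<lceil>\<alpha> / \<bar>y\<bar>\<rceil>"
    have "\<alpha> / \<bar>y\<bar> \<ge> 1" using y y0 by (simp add: \<alpha>_def)
    then have h: "\<alpha> / \<bar>y\<bar> \<le> real h" "real h \<le> 2 * (\<alpha> / \<bar>y\<bar>)"
      unfolding h_def by linarith+
    then have yh: "\<alpha> \<le> \<bar>y\<bar> * h" "\<bar>y\<bar> * h \<le> 2 * \<alpha>"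
      using y0 by (simp_all add: field_simps)
    have h_le: "real h \<le> \<delta> * n / 8"
    proof -
      have "pi / 2 * real h \<le> \<bar>y\<bar> * n * real h" using False by (intro mult_right_mono) auto
      also have "\<dots> \<le> n * (2 * \<alpha>)"
        using mult_left_mono[OF yh(2), of "real n"] by (simp add: mult_ac)
      also have "\<dots> = pi / 2 * (\<delta> * n / 8)" by (simp add: \<alpha>_def)
      finally show ?thesis by simp
    qed
    have "\<delta> / 32 * min 1 (\<bar>y\<bar> * n) \<le> \<bar>sin (y * (real j * real h))\<bar>" if j: "1 \<le> j" "j < R" for j
    proof -
      have "real j * (\<bar>y\<bar> * h) \<le> 8 / \<delta> * (2 * \<alpha>)"
        using \<delta> by (intro mult_mono[OF jR[OF j(2)] yh(2)]) auto
      then have "\<bar>y\<bar> * (real j * real h) \<le> pi / 2" using \<delta> by (simp add: \<alpha>_def mult_ac)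
      then have *: "2 / pi * (\<bar>y\<bar> * h) \<le> \<bar>sin (y * (real j * real h))\<bar>" by (intro sin_low j)
      have "\<delta> / 32 * min 1 (\<bar>y\<bar> * n) \<le> \<delta> / 16" using \<delta> by auto
      also have "\<dots> = 2 / pi * \<alpha>" by (simp add: \<alpha>_def)
      also have "\<dots> \<le> 2 / pi * (\<bar>y\<bar> * h)" using yh by (intro mult_left_mono) auto
      finally show ?thesis using * by linarith
    qed
    then show ?thesis using R h_le by blast
  qed
qed

text \<open>If two resonant points differed by \<open>j h\<close>, the addition formula would make
  \<open>sin (y j h)\<close> smaller than twice the threshold, against the choice of
  \<open>h\<close>. The packing bound then leaves at most \<open>n / R + h\<close>, and each summand
  is at most \<open>\<delta> n / 8\<close>.\<close>

lemma card_resonant_le: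
  fixes y \<delta> :: real
  assumes \<delta>: "0 < \<delta>" "\<delta> \<le> 1" and n: "real n \<ge> 8 / \<delta>" and y: "\<bar>y\<bar> \<le> pi * \<delta> / 32"
    and J: "J \<subseteq> {1..n}"
  shows "real (card {d \<in> J. \<bar>sin (y * (c - real d))\<bar> < \<delta> / 64 * min 1 (\<bar>y\<bar> * n)}) \<le> \<delta> * n / 4"
proof -
  let ?\<mu> = "min 1 (\<bar>y\<bar> * n)"
  let ?D = "{d \<in> J. \<bar>sin (y * (c - real d))\<bar> < \<delta> / 64 * ?\<mu>}"
  obtain h R :: nat where R: "real R \<ge> 8 / \<delta>" and h: "real h \<le> \<delta> * n / 8"
    and low: "\<And>j. 1 \<le> j \<Longrightarrow> j < R \<Longrightarrow> \<delta> / 32 * ?\<mu> \<le> \<bar>sin (y * (real j * real h))\<bar>"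
    using ex_shift[OF \<delta> n y] by blast
  have "d \<noteq> d' + j * h" if "1 \<le> j" "j < R" and d: "d \<in> ?D" "d' \<in> ?D" for j d d'
  proof
    assume eq: "d = d' + j * h"
    define a where "a = y * (c - real d')"
    define b where "b = y * (c - real d)"
    have "y * (real j * real h) = a - b" by (simp add: a_def b_def eq algebra_simps)
    then have "\<bar>sin (y * (real j * real h))\<bar> = \<bar>sin a * cos b - cos a * sin b\<bar>"
      by (simp add: sin_diff)
    also have "\<dots> \<le> \<bar>sin a\<bar> * \<bar>cos b\<bar> + \<bar>cos a\<bar> * \<bar>sin b\<bar>"
      by (metis abs_mult abs_triangle_ineq4)
    also have "\<dots> \<le> \<bar>sin a\<bar> * 1 + 1 * \<bar>sin b\<bar>"
      by (intro add_mono mult_left_mono mult_right_mono) auto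
    also have "\<dots> < \<delta> / 32 * ?\<mu>" using d by (simp add: a_def b_def)
    finally show False using low[of j] that by linarith
  qed
  moreover have "?D \<subseteq> {1..n}" using J by blast
  ultimately have "R * card ?D \<le> n + R * h" by (intro card_le_of_disjoint_shifts)
  then have "real (R * card ?D) \<le> real (n + R * h)" by (simp only: of_nat_le_iff)
  then have "real R * real (card ?D) \<le> real n + real R * real h"
    by (simp only: of_nat_add of_nat_mult)
  moreover have "real n \<le> real R * (\<delta> * n / 8)"
    using mult_right_mono[OF R, of "\<delta> * n / 8"] \<delta> by simp
  moreover have "real R * real h \<le> real R * (\<delta> * n / 8)" using h by (intro mult_left_mono) auto
  ultimately have "real R * real (card ?D) \<le> real R * (\<delta> * n / 4)" by simp
  moreover have "8 / \<delta> > 0" using \<delta> by simp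
  then have "real R > 0" using R by linarith
  ultimately show ?thesis by (simp only: mult_le_cancel_left_pos)
qed

lemma one_minus_exp_ge:
  fixes u :: real
  assumes "0 \<le> u" "u \<le> 1"
  shows "u / 2 \<le> 1 - exp (- u)"
proof -
  have "1 + u \<le> exp u" by (rule exp_ge_add_one_self)
  then have "exp (- u) \<le> 1 / (1 + u)"
    using assms by (simp add: exp_minus field_simps)
  also have "\<dots> \<le> 1 - u / 2"
  proof -
    have "u * u \<le> 1 * u" using assms by (intro mult_right_mono) auto
    then show ?thesis using assms by (simp add: field_simps)
  qed
  finally show ?thesis by simp
qed

text \<open>At most \<open>\<delta> n / 4\<close> partners of a given \<open>c\<close> in
  \<open>J\<close> are resonant, so at least as many are not, and each of those saves
  \<open>\<eta>\<^sup>2 / 8\<close>. All other pairs, where \<open>v\<close> is arbitrary, are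
  bounded by 1.\<close>

lemma sum_pairs_exp_sin_le:
  fixes v :: "nat \<Rightarrow> real" and x \<delta> :: real
  assumes \<delta>: "0 < \<delta>" "\<delta> \<le> 1" and n: "real n \<ge> 8 / \<delta>" and x: "\<bar>x\<bar> \<le> n * (pi * \<delta> / 32)"
    and V: "V \<subseteq> {1..n}" and J: "J \<subseteq> V" and cJ: "real (card J) \<ge> \<delta> * n / 2"
    and v: "\<And>i. i \<in> J \<Longrightarrow> v i = real i / real n"
  shows "(\<Sum>c\<in>V. \<Sum>d\<in>V - {c}. exp (- (sin (x * (v c - v d)))\<^sup>2 / 4))
    \<le> real (card V) * (real (card V) - 1) * (1 - \<delta> ^ 4 / 2 ^ 18 * (min 1 \<bar>x\<bar>)\<^sup>2)"
proof -
  let ?f = "\<lambda>c d. exp (- (sin (x * (v c - v d)))\<^sup>2 / 4)"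
  define y where "y = x / n"
  define \<eta> where "\<eta> = \<delta> / 64 * min 1 \<bar>x\<bar>"
  have n0: "n > 0" using n \<delta> by (cases n) (auto simp: field_simps)
  have finV: "finite V" using V finite_subset by blast
  have finJ: "finite J" using J finV finite_subset by blast
  have "\<delta> / 64 * min 1 \<bar>x\<bar> \<le> 1 * 1" using \<delta> by (intro mult_mono) auto
  then have \<eta>: "0 \<le> \<eta>" "\<eta> \<le> 1" using \<delta> by (auto simp: \<eta>_def)
  have yb: "\<bar>y\<bar> \<le> pi * \<delta> / 32" and yn: "\<bar>y\<bar> * n = \<bar>x\<bar>"
    using x n0 by (simp_all add: y_def field_simps)
  define D where "D = (\<lambda>c. {d \<in> J. \<bar>sin (y * (real c - real d))\<bar> < \<eta>})"
  have cD: "real (card (D c)) \<le> \<delta> * n / 4" for c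
    using card_resonant_le[OF \<delta> n yb, of J "real c"] J V by (simp add: D_def \<eta>_def yn)
  have f1: "?f c d \<le> 1" for c d by simp
  have N: "(\<Sum>c\<in>V. \<Sum>d\<in>V - {c}. (1::real)) = real (card V) * (real (card V) - 1)"
  proof (cases "V = {}")
    case False
    then have "card V \<ge> 1" using finV by (simp add: Suc_le_eq card_gt_0_iff)
    then show ?thesis using finV by (simp add: of_nat_diff)
  qed simp
  have "(\<delta> * n / 2) * ((\<delta> * n / 4) * (\<eta>\<^sup>2 / 8))
      \<le> real (card J) * ((\<delta> * n / 4) * (\<eta>\<^sup>2 / 8))"
    using cJ \<delta> by (intro mult_right_mono) auto
  also have "\<dots> = (\<Sum>c\<in>J. (\<delta> * n / 4) * (\<eta>\<^sup>2 / 8))" by simp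
  also have "\<dots> \<le> (\<Sum>c\<in>J. \<Sum>d\<in>V - {c}. 1 - ?f c d)"
  proof (rule sum_mono)
    fix c assume c: "c \<in> J"
    show "(\<delta> * n / 4) * (\<eta>\<^sup>2 / 8) \<le> (\<Sum>d\<in>V - {c}. 1 - ?f c d)"
    \<comment> \<open>For positive \<open>\<eta>\<close> the point \<open>c\<close> is itself
      resonant, so the diagonal is removed together with \<open>D c\<close>; for
      \<open>\<eta> = 0\<close> the set \<open>D c\<close> is empty and nothing has to be
      saved.\<close>
    proof (cases "\<eta> = 0")
      case True
      then show ?thesis by (simp add: sum_nonneg)
    next
      case False
      then have cDc: "c \<in> D c" using \<eta> c by (simp add: D_def)
      have "D c \<subseteq> J" by (auto simp: D_def)
      then have "card (J - D c) = card J - card (D c)" "card (D c) \<le> card J"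
        using finJ by (auto intro: card_Diff_subset finite_subset card_mono)
      then have "real (card (J - D c)) = real (card J) - real (card (D c))" by simp
      then have "\<delta> * n / 4 \<le> real (card (J - D c))" using cJ cD[of c] by linarith
      then have "(\<delta> * n / 4) * (\<eta>\<^sup>2 / 8) \<le> real (card (J - D c)) * (\<eta>\<^sup>2 / 8)"
        by (rule mult_right_mono) simp
      also have "\<dots> = (\<Sum>d\<in>J - D c. \<eta>\<^sup>2 / 8)" by simp
      also have "\<dots> \<le> (\<Sum>d\<in>J - D c. 1 - ?f c d)"
      proof (rule sum_mono)
        fix d assume d: "d \<in> J - D c"
        have "x * (v c - v d) = y * (real c - real d)"
          using v[OF c] v[of d] d by (simp add: y_def diff_divide_distrib right_diff_distrib)
        then have "\<eta> \<le> \<bar>sin (x * (v c - v d))\<bar>" using d by (auto simp: D_def)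
        then have "\<eta>\<^sup>2 \<le> (sin (x * (v c - v d)))\<^sup>2"
          using \<eta> by (metis power2_abs power_mono)
        then have "exp (- (sin (x * (v c - v d)))\<^sup>2 / 4) \<le> exp (- (\<eta>\<^sup>2 / 4))" by simp
        moreover have "\<eta>\<^sup>2 \<le> 1" using \<eta> by (simp add: power_le_one)
        then have "\<eta>\<^sup>2 / 4 / 2 \<le> 1 - exp (- (\<eta>\<^sup>2 / 4))"
          by (intro one_minus_exp_ge) auto
        ultimately show "\<eta>\<^sup>2 / 8 \<le> 1 - ?f c d" by linarith
      qed
      also have "\<dots> \<le> (\<Sum>d\<in>V - {c}. 1 - ?f c d)"
        using J cDc finV by (intro sum_mono2) auto
      finally show ?thesis .
    qed
  qed
  also have "\<dots> \<le> (\<Sum>c\<in>V. \<Sum>d\<in>V - {c}. 1 - ?f c d)"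
    using J finV by (intro sum_mono2) (auto intro!: sum_nonneg)
  also have "\<dots> = real (card V) * (real (card V) - 1) - (\<Sum>c\<in>V. \<Sum>d\<in>V - {c}. ?f c d)"
    by (simp only: sum_subtractf N)
  finally have main: "(\<delta> * n / 2) * ((\<delta> * n / 4) * (\<eta>\<^sup>2 / 8)) \<le>
      real (card V) * (real (card V) - 1) - (\<Sum>c\<in>V. \<Sum>d\<in>V - {c}. ?f c d)" .
  have "card V \<le> n" using card_mono[OF _ V] by simp
  then have "real (card V) * (real (card V) - 1) \<le> real n * real n"
    by (cases "card V = 0") (auto intro!: mult_mono)
  then have "real (card V) * (real (card V) - 1) * (\<delta> ^ 4 / 2 ^ 18 * (min 1 \<bar>x\<bar>)\<^sup>2)
      \<le> real n * real n * (\<delta> ^ 4 / 2 ^ 18 * (min 1 \<bar>x\<bar>)\<^sup>2)"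
    by (rule mult_right_mono) simp
  \<comment> \<open>Origin of \<open>2 ^ 18\<close>: the factors 2, 4 and 8, times
    \<open>64\<^sup>2\<close> from the threshold.\<close>
  also have "\<dots> = (\<delta> * n / 2) * ((\<delta> * n / 4) * (\<eta>\<^sup>2 / 8))"
    by (simp add: \<eta>_def power_mult_distrib power_divide power2_eq_square power4_eq_xxxx)
  finally show ?thesis using main by (simp only: right_diff_distrib mult_1_right)
qed

section \<open>Smoothing: from the Fourier transform to small balls\<close>

text \<open>The Fejer kernel \<open>(sin u / u)\<^sup>2\<close>, given by its compactly supported Fourier transform.\<close>

lemma fejer_kernel:
  fixes u :: real
  shows "\<exists>F. ((\<lambda>t. (1 - t / 2) * cos (u * t)) has_integral F) {0..2} \<and> 0 \<le> F \<and> (\<bar>u\<bar> \<le> 1 \<longrightarrow> 1 / 4 \<le> F)"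
proof (cases "u = 0")
  case True
  have "((\<lambda>t::real. 1 - t / 2) has_integral (2 - 2\<^sup>2 / 4 - (0 - 0\<^sup>2 / 4))) {0..2}"
    by (rule fundamental_theorem_of_calculus)
      (auto intro!: derivative_eq_intros simp flip: has_real_derivative_iff_has_vector_derivative)
  then show ?thesis using True by (intro exI[of _ 1]) simp
next
  case False
  let ?F = "\<lambda>t. (1 - t / 2) * sin (u * t) / u - cos (u * t) / (2 * u\<^sup>2)"
  have "((\<lambda>t. (1 - t / 2) * cos (u * t)) has_integral (?F 2 - ?F 0)) {0..2}"
  proof (rule fundamental_theorem_of_calculus)
    fix t
    have "(?F has_real_derivative (1 - t / 2) * cos (u * t)) (at t within {0..2})"
      using False by (auto intro!: derivative_eq_intros simp: field_simps power2_eq_square)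
    then show "(?F has_vector_derivative (1 - t / 2) * cos (u * t)) (at t within {0..2})"
      by (simp add: has_real_derivative_iff_has_vector_derivative)
  qed simp
  moreover have "?F 2 - ?F 0 = (sin u / u)\<^sup>2"
  proof -
    have "cos (u * 2) = 1 - 2 * (sin u)\<^sup>2" by (metis cos_double_sin mult.commute)
    moreover have "?F 2 - ?F 0 = (1 - cos (u * 2)) / (2 * u\<^sup>2)"
      using False by (simp add: field_simps)
    ultimately show ?thesis using False by (simp add: power_divide)
  qed
  \<comment> \<open>On this range the chord bound for the sine gives
    \<open>sin u / u \<ge> 2 / pi \<ge> 1 / 2\<close>.\<close>
  moreover have "1 / 4 \<le> (sin u / u)\<^sup>2" if "\<bar>u\<bar> \<le> 1"
  proof -
    have "2 / 4 * \<bar>u\<bar> \<le> 2 / pi * \<bar>u\<bar>"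
      using pi_less_4 by (intro mult_right_mono divide_left_mono) auto
    also have "\<dots> \<le> sin \<bar>u\<bar>" using that pi_gt3 by (intro sin_ge_jordan) auto
    finally have "1 / 2 \<le> sin \<bar>u\<bar> / \<bar>u\<bar>" using False by (simp add: field_simps)
    also have "\<dots> = sin u / u" by (cases "u \<ge> 0") auto
    finally have "(1 / 2)\<^sup>2 \<le> (sin u / u)\<^sup>2" by (intro power_mono) auto
    then show ?thesis by (simp add: power2_eq_square)
  qed
  ultimately show ?thesis by (intro exI[of _ "(sin u / u)\<^sup>2"]) simp
qed

text \<open>An Esseen-type inequality with tilt: on the ball the Fejer kernel at
  \<open>n (S - L)\<close> is at least \<open>1 / 4\<close>, and the weight
  \<open>exp (s (S - L))\<close> is at least \<open>exp (- \<bar>s\<bar> / n)\<close>. Their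
  product, nonnegative everywhere, therefore dominates the indicator up to a factor and only
  involves frequencies up to \<open>2 n\<close>.\<close>

lemma card_small_ball_le:
  fixes S :: "'b \<Rightarrow> real" and n s L J :: real
  assumes fin: "finite P" and n: "n > 0"
    and G: "\<And>t. t \<in> {0..2} \<Longrightarrow> norm (\<Sum>\<pi>\<in>P. exp (Complex s (n * t) * of_real (S \<pi>))) \<le> G t"
    and J: "(G has_integral J) {0..2}"
  shows "real (card {\<pi> \<in> P. \<bar>S \<pi> - L\<bar> \<le> 1 / n}) \<le> 4 * exp (\<bar>s\<bar> / n) * (exp (- (s * L)) * J)"
proof -
  let ?k = "\<lambda>\<pi> t. (1 - t / 2) * cos (n * (S \<pi> - L) * t)"
  let ?x = "\<lambda>\<pi>. exp (s * (S \<pi> - L))"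
  have "\<exists>F. \<forall>\<pi>. (?k \<pi> has_integral F \<pi>) {0..2} \<and> 0 \<le> F \<pi> \<and>
      (\<bar>n * (S \<pi> - L)\<bar> \<le> 1 \<longrightarrow> 1 / 4 \<le> F \<pi>)"
    by (intro choice allI fejer_kernel)
  then obtain F where F: "\<And>\<pi>. (?k \<pi> has_integral F \<pi>) {0..2}" "\<And>\<pi>. 0 \<le> F \<pi>"
      "\<And>\<pi>. \<bar>n * (S \<pi> - L)\<bar> \<le> 1 \<Longrightarrow> 1 / 4 \<le> F \<pi>" by blast
  have "real (card {\<pi> \<in> P. \<bar>S \<pi> - L\<bar> \<le> 1 / n}) = (\<Sum>\<pi>\<in>{\<pi> \<in> P. \<bar>S \<pi> - L\<bar> \<le> 1 / n}. 1)"
    by simp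
  also have "\<dots> \<le> (\<Sum>\<pi>\<in>{\<pi> \<in> P. \<bar>S \<pi> - L\<bar> \<le> 1 / n}. 4 * exp (\<bar>s\<bar> / n) * (?x \<pi> * F \<pi>))"
  proof (rule sum_mono)
    fix \<pi> assume "\<pi> \<in> {\<pi> \<in> P. \<bar>S \<pi> - L\<bar> \<le> 1 / n}"
    then have *: "\<bar>S \<pi> - L\<bar> \<le> 1 / n" by simp
    then have "\<bar>n * (S \<pi> - L)\<bar> \<le> 1" using n by (simp add: abs_mult pos_le_divide_eq mult.commute)
    then have "1 / 4 \<le> F \<pi>" by (rule F)
    moreover have "1 \<le> exp (\<bar>s\<bar> / n) * ?x \<pi>"
    proof -
      have "\<bar>s * (S \<pi> - L)\<bar> \<le> \<bar>s\<bar> * (1 / n)"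
        unfolding abs_mult using * by (rule mult_left_mono) simp
      then have "0 \<le> \<bar>s\<bar> / n + s * (S \<pi> - L)" by simp
      then have "1 \<le> exp (\<bar>s\<bar> / n + s * (S \<pi> - L))" by simp
      then show ?thesis by (simp only: exp_add)
    qed
    ultimately have "1 * (1 / 4) \<le> (exp (\<bar>s\<bar> / n) * ?x \<pi>) * F \<pi>"
      by (intro mult_mono) auto
    then show "1 \<le> 4 * exp (\<bar>s\<bar> / n) * (?x \<pi> * F \<pi>)" by (simp add: mult_ac)
  qed
  also have "\<dots> \<le> (\<Sum>\<pi>\<in>P. 4 * exp (\<bar>s\<bar> / n) * (?x \<pi> * F \<pi>))"
    using fin F(2) by (intro sum_mono2) auto
  also have "\<dots> = 4 * exp (\<bar>s\<bar> / n) * (\<Sum>\<pi>\<in>P. ?x \<pi> * F \<pi>)"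
    by (simp only: sum_distrib_left)
  also have "\<dots> \<le> 4 * exp (\<bar>s\<bar> / n) * (exp (- (s * L)) * J)"
  proof (intro mult_left_mono)
    show "(\<Sum>\<pi>\<in>P. ?x \<pi> * F \<pi>) \<le> exp (- (s * L)) * J"
    proof (rule has_integral_le)
      show "((\<lambda>t. \<Sum>\<pi>\<in>P. ?x \<pi> * ?k \<pi> t) has_integral (\<Sum>\<pi>\<in>P. ?x \<pi> * F \<pi>)) {0..2}"
        using fin by (intro has_integral_sum has_integral_mult_right F)
      show "((\<lambda>t. exp (- (s * L)) * G t) has_integral exp (- (s * L)) * J) {0..2}"
        by (intro has_integral_mult_right J)
      fix t :: real assume t: "t \<in> {0..2}"
      let ?z = "Complex s (n * t)"
      let ?T = "\<Sum>\<pi>\<in>P. exp (?z * of_real (S \<pi>))"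
      \<comment> \<open>Tilt times cosine is the real part of one complex exponential, so only the
        modulus of the tilted transform enters.\<close>
      have "(\<Sum>\<pi>\<in>P. ?x \<pi> * ?k \<pi> t) = (\<Sum>\<pi>\<in>P. (1 - t / 2) * Re (exp (?z * of_real (S \<pi> - L))))"
        by (intro sum.cong refl) (simp add: Re_exp mult_ac)
      also have "\<dots> = (1 - t / 2) * Re (\<Sum>\<pi>\<in>P. exp (?z * of_real (S \<pi> - L)))"
        by (simp only: sum_distrib_left Re_sum)
      also have "(\<Sum>\<pi>\<in>P. exp (?z * of_real (S \<pi> - L))) = exp (- (?z * of_real L)) * ?T"
        unfolding sum_distrib_left
        by (intro sum.cong refl) (simp add: algebra_simps flip: exp_add)
      also have "(1 - t / 2) * Re (exp (- (?z * of_real L)) * ?T)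
          \<le> 1 * norm (exp (- (?z * of_real L)) * ?T)"
      proof -
        have "(1 - t / 2) * Re (exp (- (?z * of_real L)) * ?T)
          \<le> (1 - t / 2) * norm (exp (- (?z * of_real L)) * ?T)"
          using t by (intro mult_left_mono complex_Re_le_cmod) auto
        also have "\<dots> \<le> 1 * norm (exp (- (?z * of_real L)) * ?T)"
          using t by (intro mult_right_mono) auto
        finally show ?thesis .
      qed
      also have "\<dots> = exp (- (s * L)) * norm ?T" by (simp add: norm_mult)
      also have "\<dots> \<le> exp (- (s * L)) * G t" using G[OF t] by (intro mult_left_mono) auto
      finally show "(\<Sum>\<pi>\<in>P. ?x \<pi> * ?k \<pi> t) \<le> exp (- (s * L)) * G t" .
    qed
  qed simp
  finally show ?thesis .
qed

text \<open>Gaussian decay is weakened to \<open>1 / (1 + x\<^sup>2)\<close>, whose primitive is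
  explicit and bounded; this suffices for an integral of order \<open>1 / k\<close>.\<close>

lemma has_integral_lorentzian:
  fixes k C q :: real
  assumes "k > 0"
  shows "((\<lambda>t. C * (1 / (1 + (k * t)\<^sup>2) + q)) has_integral C * (arctan (k * 2) / k + 2 * q)) {0..2}"
proof -
  have "((\<lambda>t. C * (1 / (1 + (k * t)\<^sup>2) + q)) has_integral
      (C * (arctan (k * 2) / k + 2 * q) - C * (arctan (k * 0) / k + 0 * q))) {0..2}"
  proof (rule fundamental_theorem_of_calculus)
    fix t
    have "((\<lambda>t. C * (arctan (k * t) / k + t * q)) has_real_derivative
        C * (1 / (1 + (k * t)\<^sup>2) + q)) (at t within {0..2})"
      using assms by (auto intro!: derivative_eq_intros simp: field_simps)
    then show "((\<lambda>t. C * (arctan (k * t) / k + t * q)) has_vector_derivative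
        C * (1 / (1 + (k * t)\<^sup>2) + q)) (at t within {0..2})"
      by (simp add: has_real_derivative_iff_has_vector_derivative)
  qed simp
  then show ?thesis by simp
qed

section \<open>Decay of the Fourier transform\<close>

lemma sum_perms_prod_exp_sin_le:
  fixes w v :: "nat \<Rightarrow> real" and \<delta> \<epsilon> \<theta> :: real
  assumes \<delta>: "0 < \<delta>" "\<delta> \<le> 1" and n: "real n \<ge> 8 / \<delta>"
    and inj: "inj_on e {..<2 * m}" and img: "e ` {..<2 * m} \<subseteq> {1..n}"
    and m: "real m \<le> \<delta> * n / 4"
    and eq: "equispaced_on \<delta> n I v"
    and d: "\<And>k. k < m \<Longrightarrow> \<bar>w (e (2 * k)) - w (e (2 * k + 1))\<bar> \<le> \<epsilon>"
    and \<epsilon>: "\<epsilon> \<le> pi * \<delta> / 32" and \<theta>: "0 \<le> \<theta>" "\<theta> \<le> 2 * real n"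
  shows "(\<Sum>\<pi>\<in>perms n. \<Prod>k<m. exp (- (sin (\<theta> * pair_gap e w v k \<pi>))\<^sup>2 / 4))
    \<le> fact n * exp (- (\<delta> ^ 4 / 2 ^ 18) *
        (\<Sum>k<m. (min 1 (\<theta> * \<bar>w (e (2 * k)) - w (e (2 * k + 1))\<bar> / 2))\<^sup>2))"
proof -
  define x where "x = (\<lambda>k. \<theta> * (w (e (2 * k)) - w (e (2 * k + 1))) / 2)"
  define r where "r = (\<lambda>k. 1 - \<delta> ^ 4 / 2 ^ 18 * (min 1 \<bar>x k\<bar>)\<^sup>2)"
  have I: "I \<subseteq> {1..n}" "real (card I) \<ge> \<delta> * n" "\<And>i. i \<in> I \<Longrightarrow> v i = real i / real n"
    using eq by (auto simp: equispaced_on_def)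
  have cm: "2 * m \<le> n" using card_mono[OF _ img] card_image[OF inj] by simp
  have r0: "r k \<ge> 0" for k
  proof -
    have "\<delta> ^ 4 / 2 ^ 18 \<le> 1" using power_le_one[of \<delta> 4] \<delta> by simp
    moreover have "(min 1 \<bar>x k\<bar>)\<^sup>2 \<le> 1" by (intro power_le_one) auto
    ultimately have "\<delta> ^ 4 / 2 ^ 18 * (min 1 \<bar>x k\<bar>)\<^sup>2 \<le> 1 * 1"
      using \<delta> by (intro mult_mono) auto
    then show ?thesis by (simp add: r_def)
  qed
  have "(\<Sum>\<pi>\<in>perms n. \<Prod>k<m. exp (- (sin (\<theta> * pair_gap e w v k \<pi>))\<^sup>2 / 4))
      = (\<Sum>\<pi>\<in>perms n. \<Prod>k<m. exp (- (sin (x k * (v (\<pi> (e (2 * k))) - v (\<pi> (e (2 * k + 1))))))\<^sup>2 / 4))"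
    by (simp add: pair_gap_def x_def mult.assoc)
  also have "\<dots> \<le> fact n * (\<Prod>k<m. r k)"
  proof (rule sum_perms_prod_le[OF inj img _ _ _ order.refl])
    fix k V assume k: "k < m" and V: "V \<subseteq> {1..n}" "card V = n - 2 * k"
    have finV: "finite V" using V finite_subset by blast
    have "I - ({1..n} - V) \<subseteq> V \<inter> I" using I by blast
    then have "card (I - ({1..n} - V)) \<le> card (V \<inter> I)" using finV by (intro card_mono) auto
    moreover have "card I - card ({1..n} - V) \<le> card (I - ({1..n} - V))"
      by (rule diff_card_le_card_Diff) simp
    moreover have "card ({1..n} - V) = 2 * k"
      using V finV k cm by (simp add: card_Diff_subset)
    ultimately have "real (card I) \<le> real (card (V \<inter> I)) + 2 * real k" by linarith
    \<comment> \<open>Fewer than \<open>2 * m \<le> \<delta> n / 2\<close> values have been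
      revealed, so at least half of the guaranteed part of \<open>I\<close> is still
      available.\<close>
    then have cJ: "real (card (V \<inter> I)) \<ge> \<delta> * n / 2" using I(2) m k by linarith
    \<comment> \<open>Here the frequency cutoff and the small weight gaps exclude the resonances
      beyond the first period.\<close>
    have "\<bar>x k\<bar> = \<theta> / 2 * \<bar>w (e (2 * k)) - w (e (2 * k + 1))\<bar>"
      using \<theta> by (simp add: x_def abs_mult)
    also have "\<dots> \<le> n * (pi * \<delta> / 32)"
      using d[OF k] \<epsilon> \<theta> by (intro mult_mono) auto
    finally show "(\<Sum>c\<in>V. \<Sum>d\<in>V - {c}. exp (- (sin (x k * (v c - v d)))\<^sup>2 / 4))
        \<le> real (card V) * (real (card V) - 1) * r k"
      unfolding r_def using \<delta> n V(1) cJ I(3)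
      by (intro sum_pairs_exp_sin_le[where J = "V \<inter> I"]) auto
  qed (use r0 in auto)
  also have "(\<Prod>k<m. r k) \<le> (\<Prod>k<m. exp (- (\<delta> ^ 4 / 2 ^ 18) * (min 1 \<bar>x k\<bar>)\<^sup>2))"
  proof (intro prod_mono conjI r0)
    fix k
    show "r k \<le> exp (- (\<delta> ^ 4 / 2 ^ 18) * (min 1 \<bar>x k\<bar>)\<^sup>2)"
      using exp_ge_add_one_self[of "- (\<delta> ^ 4 / 2 ^ 18) * (min 1 \<bar>x k\<bar>)\<^sup>2"] by (simp add: r_def)
  qed
  also have "\<dots> = exp (- (\<delta> ^ 4 / 2 ^ 18) * (\<Sum>k<m. (min 1 \<bar>x k\<bar>)\<^sup>2))"
    by (simp only: exp_sum[OF finite_lessThan] sum_distrib_left)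
  also have "(\<Sum>k<m. (min 1 \<bar>x k\<bar>)\<^sup>2)
      = (\<Sum>k<m. (min 1 (\<theta> * \<bar>w (e (2 * k)) - w (e (2 * k + 1))\<bar> / 2))\<^sup>2)"
    using \<theta> by (simp add: x_def abs_mult)
  finally show ?thesis by simp
qed

text \<open>Up to frequency \<open>2 A sqrt (ln n)\<close> the decay is Gaussian; beyond it the exponent stays at the
  value reached there, which is of order \<open>A\<^sup>2 ln n\<close>. This is what the bound on the
  differences of the weights is for.\<close>

lemma exp_sum_min_le:
  fixes d :: "nat \<Rightarrow> real" and \<theta> \<delta> c A :: real
  assumes \<delta>: "\<delta> > 0" and c: "c > 0" and n: "n \<ge> (2::nat)" and A: "A > 0" "c * \<delta> * A\<^sup>2 \<ge> 8"
    and d0: "\<And>k. k < m \<Longrightarrow> 0 \<le> d k" and d: "\<And>k. k < m \<Longrightarrow> d k \<le> 1 / (A * sqrt (ln n))"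
    and sum: "(\<Sum>k<m. (d k)\<^sup>2) \<ge> \<delta> / 4" and \<theta>: "\<theta> \<ge> 0"
  shows "sqrt (exp (- c * (\<Sum>k<m. (min 1 (\<theta> * d k / 2))\<^sup>2)))
    \<le> 1 / (1 + c * \<delta> / 32 * \<theta>\<^sup>2) + 1 / n"
proof -
  define \<epsilon> where "\<epsilon> = 1 / (A * sqrt (ln n))"
  have ln: "ln (real n) > 0" using n by simp
  have \<epsilon>: "\<epsilon> > 0" using ln A by (simp add: \<epsilon>_def)
  have sqrt_exp: "sqrt (exp x) = exp (x / 2)" for x :: real
    by (rule real_sqrt_unique) (simp_all flip: exp_double)
  show ?thesis
  \<comment> \<open>In this range no minimum is truncated, and the sum is exactly quadratic in
    \<open>\<theta>\<close>.\<close>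
  proof (cases "\<theta> * \<epsilon> \<le> 2")
    case True
    have "\<theta> * d k \<le> 2" if "k < m" for k
      using mult_left_mono[OF d[OF that] \<theta>] True by (simp add: \<epsilon>_def)
    then have "(\<Sum>k<m. (min 1 (\<theta> * d k / 2))\<^sup>2) = (\<Sum>k<m. \<theta>\<^sup>2 / 4 * (d k)\<^sup>2)"
      by (intro sum.cong refl) (simp add: min_absorb2 power_divide power_mult_distrib)
    also have "\<dots> = \<theta>\<^sup>2 / 4 * (\<Sum>k<m. (d k)\<^sup>2)" by (simp only: sum_distrib_left)
    also have "\<dots> \<ge> \<theta>\<^sup>2 / 4 * (\<delta> / 4)" using sum by (intro mult_left_mono) auto
    finally have "c * (\<Sum>k<m. (min 1 (\<theta> * d k / 2))\<^sup>2) \<ge> c * (\<theta>\<^sup>2 / 4 * (\<delta> / 4))"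
      using c by (intro mult_left_mono) auto
    then have "sqrt (exp (- c * (\<Sum>k<m. (min 1 (\<theta> * d k / 2))\<^sup>2))) \<le> exp (- (c * \<delta> / 32 * \<theta>\<^sup>2))"
      unfolding sqrt_exp by (simp add: mult.commute mult.left_commute)
    also have "\<dots> \<le> 1 / (1 + c * \<delta> / 32 * \<theta>\<^sup>2)"
    proof -
      have "0 \<le> c * \<delta> / 32 * \<theta>\<^sup>2" using c \<delta> by simp
      then show ?thesis
        using exp_ge_add_one_self[of "c * \<delta> / 32 * \<theta>\<^sup>2"]
        by (simp only: exp_minus inverse_eq_divide) (intro divide_left_mono, auto)
    qed
    finally show ?thesis by (simp add: add_increasing2)
  next
    case False
    have "\<delta> / 4 * (1 / \<epsilon>)\<^sup>2 \<le> (\<Sum>k<m. (d k)\<^sup>2) * (1 / \<epsilon>)\<^sup>2"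
      using sum by (intro mult_right_mono) auto
    also have "\<dots> = (\<Sum>k<m. (d k / \<epsilon>)\<^sup>2)"
      by (simp add: power_divide sum_divide_distrib)
    \<comment> \<open>Beyond \<open>2 / \<epsilon>\<close> each term is at least its value at that
      frequency, namely \<open>(d k / \<epsilon>)\<^sup>2\<close>.\<close>
    also have "\<dots> \<le> (\<Sum>k<m. (min 1 (\<theta> * d k / 2))\<^sup>2)"
    proof (intro sum_mono power_mono)
      fix k assume "k \<in> {..<m}"
      then have k: "k < m" by simp
      have "d k \<le> \<epsilon>" using d[OF k] by (simp only: \<epsilon>_def)
      then have "d k / \<epsilon> \<le> 1" using \<epsilon> by simp
      moreover have "2 * d k \<le> (\<theta> * \<epsilon>) * d k"
        using False d0[OF k] by (intro mult_right_mono) auto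
      then have "d k / \<epsilon> \<le> \<theta> * d k / 2" using \<epsilon> by (simp add: field_simps)
      ultimately show "d k / \<epsilon> \<le> min 1 (\<theta> * d k / 2)" by simp
      show "0 \<le> d k / \<epsilon>" using d0[OF k] \<epsilon> by simp
    qed
    finally have "c * (\<Sum>k<m. (min 1 (\<theta> * d k / 2))\<^sup>2) \<ge> c * (\<delta> / 4 * (1 / \<epsilon>)\<^sup>2)"
      using c by (intro mult_left_mono) auto
    moreover have "(1 / \<epsilon>)\<^sup>2 = A\<^sup>2 * ln n"
      using ln by (simp add: \<epsilon>_def power_mult_distrib)
    moreover have "8 * ln n \<le> c * \<delta> * A\<^sup>2 * ln n" using A(2) ln by (intro mult_right_mono) auto
    ultimately have "c * (\<Sum>k<m. (min 1 (\<theta> * d k / 2))\<^sup>2) \<ge> 2 * ln n"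
      by (simp add: mult_ac)
    then have "sqrt (exp (- c * (\<Sum>k<m. (min 1 (\<theta> * d k / 2))\<^sup>2))) \<le> exp (- ln n)"
      unfolding sqrt_exp by simp
    also have "\<dots> = 1 / n" using n by (simp add: exp_minus inverse_eq_divide)
    finally show ?thesis using c \<delta> by (simp add: add_increasing)
  qed
qed

section \<open>Small ball estimates, with and without tilt\<close>

lemma small_ball_prob_eq:
  "small_ball_prob n w v L =
    real (card {\<pi> \<in> perms n. \<bar>perm_sum n w v \<pi> - L\<bar> \<le> 1 / real n}) / fact n"
  unfolding small_ball_prob_def uniform_perm_def
  by (subst measure_pmf_of_set[OF perms_nonempty finite_perms])
    (use card_perms[of n] in \<open>simp add: Collect_conj_eq\<close>)

text \<open>The common core of both parts: (a) is \<open>s = 0\<close>, \<open>Q = 1\<close>. The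
  square on \<open>Q\<close> and the doubled tilt come from Cauchy-Schwarz; the bound 2 on the
  tilted differences makes each half-difference at most 1, as the complex \<open>cosh\<close>
  estimate requires.\<close>

lemma small_ball_tilted:
  fixes w v :: "nat \<Rightarrow> real" and \<delta> A s Q L :: real
  assumes \<delta>: "0 < \<delta>" "\<delta> \<le> 1" and n: "real n \<ge> 8 / \<delta>" and A: "A \<ge> 2 ^ 11 / \<delta> ^ 5"
    and w: "admissible_weights A n w" and eq: "equispaced_on \<delta> n I v"
    and small: "\<And>i j a b. i \<in> {1..n} \<Longrightarrow> j \<in> {1..n} \<Longrightarrow> i \<noteq> j \<Longrightarrow> a \<in> {1..n} \<Longrightarrow> b \<in> {1..n} \<Longrightarrow>
      \<bar>s * ((w i - w j) * (v a - v b))\<bar> \<le> 2"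
    and Q: "Q \<ge> 0" and mgf: "(\<Sum>\<pi>\<in>perms n. exp (2 * s * perm_sum n w v \<pi>)) \<le> fact n * Q\<^sup>2"
  shows "small_ball_prob n w v L
    \<le> (8 / sqrt (\<delta> ^ 5 / 2 ^ 23) + 8) / n * (exp (\<bar>s\<bar> / n) * exp (- (s * L)) * Q)"
proof -
  define m where "m = nat \<lfloor>\<delta> * n / 4\<rfloor>"
  \<comment> \<open>The coefficient of \<open>\<theta>\<^sup>2\<close> in the Lorentzian: the saving
    \<open>\<delta> ^ 4 / 2 ^ 18\<close> per pair, times \<open>\<delta> / 32\<close> from the
    spread of the chosen pairs.\<close>
  define b where "b = \<delta> ^ 5 / 2 ^ 23"
  define \<kappa> where "\<kappa> = sqrt b"
  have b: "b > 0" using \<delta> by (simp add: b_def)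
  then have \<kappa>: "\<kappa> > 0" "\<kappa>\<^sup>2 = b" by (simp_all add: \<kappa>_def)
  have dn: "\<delta> * n \<ge> 8" using n \<delta> by (simp add: field_simps)
  have n8: "n \<ge> 8"
  proof -
    have "\<delta> * n \<le> 1 * real n" using \<delta> by (intro mult_right_mono) auto
    then show ?thesis using dn by simp
  qed
  have m: "real m \<le> \<delta> * n / 4" "real m \<ge> \<delta> * n / 8"
    using dn unfolding m_def by linarith+
  have "real (2 * m) \<le> n" using m mult_right_mono[OF \<delta>(2), of "real n"] by simp
  then have m2: "2 * m \<le> n" by linarith
  have w0: "(\<Sum>i=1..n. w i) = 0" and w1: "(\<Sum>i=1..n. (w i)\<^sup>2) = 1"
    and w2: "\<And>i j. i \<in> {1..n} \<Longrightarrow> j \<in> {1..n} \<Longrightarrow> i \<noteq> j \<Longrightarrow> \<bar>w i - w j\<bar> \<le> 1 / (A * sqrt (ln n))"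
    using w by (auto simp: admissible_weights_def)
  obtain e where inj: "inj_on e {..<2 * m}" and img: "e ` {..<2 * m} \<subseteq> {1..n}"
    and spread: "(\<Sum>k<m. (w (e (2 * k)) - w (e (2 * k + 1)))\<^sup>2) \<ge> 2 * real m / real n"
    using ex_spread_pairs[OF w0 w1 m2] n8 by auto
  define d where "d = (\<lambda>k. \<bar>w (e (2 * k)) - w (e (2 * k + 1))\<bar>)"
  have e: "e (2 * k) \<in> {1..n}" "e (2 * k + 1) \<in> {1..n}" "e (2 * k) \<noteq> e (2 * k + 1)" if "k < m" for k
    using that img by (auto simp: image_subset_iff inj_on_eq_iff[OF inj])
  have d: "d k \<le> 1 / (A * sqrt (ln n))" if "k < m" for k
    unfolding d_def using e[OF that] by (intro w2)
  have sumd: "(\<Sum>k<m. (d k)\<^sup>2) \<ge> \<delta> / 4"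
  proof -
    have "\<delta> / 4 \<le> 2 * real m / real n" using m n8 by (simp add: field_simps)
    then show ?thesis using spread by (simp add: d_def)
  qed
  have \<delta>5: "\<delta> ^ 5 > 0" "\<delta> ^ 5 \<le> \<delta>" using \<delta> power_decreasing[of 1 5 \<delta>] by auto
  have "2 ^ 11 / \<delta> ^ 5 > 0" using \<delta>5 by simp
  then have A0: "A > 0" using A by linarith
  have A\<delta>: "A * \<delta> ^ 5 \<ge> 2 ^ 11" using A \<delta>5 by (simp add: pos_divide_le_eq)
  have "A * \<delta> ^ 5 \<le> A * 1" using A0 \<delta>5 \<delta> by (intro mult_left_mono) auto
  then have A1: "A \<ge> 2 ^ 11" using A\<delta> by simp
  \<comment> \<open>This makes the high-frequency part at most \<open>1 / n\<close>, and it
    determines how large \<open>A\<close> must be; the non-resonance condition on the gaps only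
    needs \<open>A * \<delta> \<ge> 64\<close>.\<close>
  have cA: "\<delta> ^ 4 / 2 ^ 18 * \<delta> * A\<^sup>2 \<ge> 8"
  proof -
    have "2 ^ 11 * 2 ^ 11 \<le> (A * \<delta> ^ 5) * A" using A\<delta> A1 A0 \<delta>5 by (intro mult_mono) auto
    moreover have "\<delta> ^ 4 * \<delta> = \<delta> ^ 5" by (simp add: eval_nat_numeral)
    ultimately show ?thesis by (simp add: power2_eq_square mult_ac)
  qed
  have \<epsilon>: "1 / (A * sqrt (ln n)) \<le> pi * \<delta> / 32"
  proof -
    have "exp (1 / 4 :: real) \<le> exp 1" by simp
    also have "\<dots> \<le> 8" using exp_le by linarith
    also have "\<dots> \<le> n" using n8 by simp
    finally have "1 / 4 \<le> ln n" using n8 by (subst ln_ge_iff) auto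
    then have "sqrt (1 / 4) \<le> sqrt (ln n)" by (rule real_sqrt_le_mono)
    then have "1 / 2 \<le> sqrt (ln n)" by (simp add: real_sqrt_divide)
    then have "A * (1 / 2) \<le> A * sqrt (ln n)" using A0 by (intro mult_left_mono) auto
    then have "1 / (A * sqrt (ln n)) \<le> 1 / (A * (1 / 2))" using A0 by (intro frac_le) auto
    also have "\<dots> \<le> \<delta> / 32"
    proof -
      have "A * \<delta> ^ 5 \<le> A * \<delta>" using A0 \<delta>5 by (intro mult_left_mono) auto
      moreover have "64 \<le> A * \<delta> ^ 5" using A\<delta> by simp
      ultimately have "64 \<le> A * \<delta>" by (rule order_trans[rotated])
      then show ?thesis using A0 by (simp add: field_simps)
    qed
    also have "\<dots> \<le> pi * \<delta> / 32" using \<delta> pi_gt3 by simp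
    finally show ?thesis .
  qed
  define G where "G = (\<lambda>t::real. fact n * Q * (1 / (1 + (\<kappa> * n * t)\<^sup>2) + 1 / n))"
  define J where "J = fact n * Q * (arctan (\<kappa> * n * 2) / (\<kappa> * n) + 2 * (1 / n))"
  have GJ: "(G has_integral J) {0..2}"
    unfolding G_def J_def using \<kappa> n8 by (intro has_integral_lorentzian) auto
  have bound: "norm (\<Sum>\<pi>\<in>perms n. exp (Complex s (n * t) * of_real (perm_sum n w v \<pi>))) \<le> G t"
    if t: "t \<in> {0..2}" for t :: real
  proof -
    define \<theta> where "\<theta> = n * t"
    have \<theta>: "0 \<le> \<theta>" "\<theta> \<le> 2 * real n" using t mult_left_mono[of t 2 "real n"] by (auto simp: \<theta>_def)
    have sg: "\<bar>s * pair_gap e w v k \<pi>\<bar> \<le> 1" if "k < m" "\<pi> \<in> perms n" for k \<pi>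
    proof -
      have "\<pi> i \<in> {1..n}" if "i \<in> {1..n}" for i
        using \<open>\<pi> \<in> perms n\<close> that permutes_in_image by (metis mem_Collect_eq)
      then have "\<bar>s * ((w (e (2 * k)) - w (e (2 * k + 1))) *
          (v (\<pi> (e (2 * k))) - v (\<pi> (e (2 * k + 1)))))\<bar> \<le> 2"
        using e[OF \<open>k < m\<close>] by (intro small)
      then show ?thesis by (simp add: pair_gap_def)
    qed
    have "norm (\<Sum>\<pi>\<in>perms n. exp (Complex s \<theta> * of_real (perm_sum n w v \<pi>)))
      \<le> sqrt (\<Sum>\<pi>\<in>perms n. exp (2 * s * perm_sum n w v \<pi>)) *
        sqrt (\<Sum>\<pi>\<in>perms n. \<Prod>k<m. exp (- (sin (\<theta> * pair_gap e w v k \<pi>))\<^sup>2 / 4))"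
      by (rule norm_sum_exp_le[OF inj img sg])
    also have "\<dots> \<le> sqrt (fact n * Q\<^sup>2) *
        sqrt (fact n * exp (- (\<delta> ^ 4 / 2 ^ 18) * (\<Sum>k<m. (min 1 (\<theta> * d k / 2))\<^sup>2)))"
    proof (intro mult_mono real_sqrt_le_mono mgf)
      show "(\<Sum>\<pi>\<in>perms n. \<Prod>k<m. exp (- (sin (\<theta> * pair_gap e w v k \<pi>))\<^sup>2 / 4))
        \<le> fact n * exp (- (\<delta> ^ 4 / 2 ^ 18) * (\<Sum>k<m. (min 1 (\<theta> * d k / 2))\<^sup>2))"
        unfolding d_def
        using sum_perms_prod_exp_sin_le[OF \<delta> n inj img m(1) eq d[unfolded d_def] \<epsilon> \<theta>] .
    qed (auto simp: sum_nonneg prod_nonneg)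
    also have "\<dots> = fact n * Q *
        sqrt (exp (- (\<delta> ^ 4 / 2 ^ 18) * (\<Sum>k<m. (min 1 (\<theta> * d k / 2))\<^sup>2)))"
      using Q by (simp add: real_sqrt_mult)
    also have "\<dots> \<le> fact n * Q * (1 / (1 + \<delta> ^ 4 / 2 ^ 18 * \<delta> / 32 * \<theta>\<^sup>2) + 1 / n)"
    proof (intro mult_left_mono)
      show "sqrt (exp (- (\<delta> ^ 4 / 2 ^ 18) * (\<Sum>k<m. (min 1 (\<theta> * d k / 2))\<^sup>2)))
          \<le> 1 / (1 + \<delta> ^ 4 / 2 ^ 18 * \<delta> / 32 * \<theta>\<^sup>2) + 1 / n"
        using \<delta> n8 A0 cA d sumd \<theta> by (intro exp_sum_min_le) (auto simp: d_def)
    qed (use Q in auto)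
    also have "\<delta> ^ 4 / 2 ^ 18 * \<delta> / 32 = b" by (simp add: b_def eval_nat_numeral)
    also have "b * \<theta>\<^sup>2 = (\<kappa> * n * t)\<^sup>2" by (simp add: \<theta>_def power_mult_distrib \<kappa>(2))
    finally show ?thesis by (simp only: G_def \<theta>_def)
  qed
  have J_le: "J \<le> fact n * Q * ((2 / \<kappa> + 2) / n)"
  proof -
    have "arctan (\<kappa> * n * 2) \<le> 2" using arctan_ubound[of "\<kappa> * n * 2"] pi_less_4 by linarith
    then have "arctan (\<kappa> * n * 2) / (\<kappa> * n) \<le> 2 / (\<kappa> * n)"
      using \<kappa> by (intro divide_right_mono) auto
    then have "arctan (\<kappa> * n * 2) / (\<kappa> * n) + 2 * (1 / n) \<le> (2 / \<kappa> + 2) / n"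
      by (simp add: add_divide_distrib)
    then show ?thesis unfolding J_def using Q by (intro mult_left_mono) auto
  qed
  have "real (card {\<pi> \<in> perms n. \<bar>perm_sum n w v \<pi> - L\<bar> \<le> 1 / n})
      \<le> 4 * exp (\<bar>s\<bar> / n) * (exp (- (s * L)) * J)"
    by (rule card_small_ball_le[OF finite_perms _ bound GJ]) (use n8 in auto)
  also have "\<dots> \<le> 4 * exp (\<bar>s\<bar> / n) * (exp (- (s * L)) * (fact n * Q * ((2 / \<kappa> + 2) / n)))"
    using J_le by (intro mult_left_mono) auto
  also have "\<dots> = fact n * ((8 / \<kappa> + 8) / n * (exp (\<bar>s\<bar> / n) * exp (- (s * L)) * Q))"
    by (simp add: add_divide_distrib algebra_simps)
  finally have "small_ball_prob n w v L
      \<le> (8 / \<kappa> + 8) / n * (exp (\<bar>s\<bar> / n) * exp (- (s * L)) * Q)"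
    unfolding small_ball_prob_eq by (subst pos_divide_le_eq) (simp_all only: fact_gt_zero mult.commute)
  then show ?thesis by (simp only: \<kappa>_def b_def)
qed

text \<open>Exponential Markov inequality without smoothing. It has no factor \<open>1 / n\<close>
  and serves small \<open>n\<close>, and large \<open>L\<close>, where half of the exponent pays for
  that factor.\<close>

lemma small_ball_chernoff:
  fixes w v :: "nat \<Rightarrow> real"
  assumes w: "admissible_weights A n w" and vB: "\<forall>i\<in>{1..n}. \<bar>v i\<bar> \<le> B" and n: "n > 0"
  shows "small_ball_prob n w v L \<le> exp (\<bar>s\<bar> / n) * exp (- (s * L)) * exp (2 * B\<^sup>2 * s\<^sup>2)"
proof -
  let ?S = "perm_sum n w v"
  have "real (card {\<pi> \<in> perms n. \<bar>?S \<pi> - L\<bar> \<le> 1 / n}) = (\<Sum>\<pi>\<in>{\<pi> \<in> perms n. \<bar>?S \<pi> - L\<bar> \<le> 1 / n}. 1)"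
    by simp
  also have "\<dots> \<le> (\<Sum>\<pi>\<in>{\<pi> \<in> perms n. \<bar>?S \<pi> - L\<bar> \<le> 1 / n}.
      exp (\<bar>s\<bar> / n) * exp (- (s * L)) * exp (s * ?S \<pi>))"
  proof (rule sum_mono)
    fix \<pi> assume "\<pi> \<in> {\<pi> \<in> perms n. \<bar>?S \<pi> - L\<bar> \<le> 1 / n}"
    then have "\<bar>s * (?S \<pi> - L)\<bar> \<le> \<bar>s\<bar> * (1 / n)"
      unfolding abs_mult by (intro mult_left_mono) auto
    then have "0 \<le> \<bar>s\<bar> / n + - (s * L) + s * ?S \<pi>" by (simp add: algebra_simps)
    then have "1 \<le> exp (\<bar>s\<bar> / n + - (s * L) + s * ?S \<pi>)" by simp
    then show "1 \<le> exp (\<bar>s\<bar> / n) * exp (- (s * L)) * exp (s * ?S \<pi>)" by (simp only: exp_add)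
  qed
  also have "\<dots> \<le> (\<Sum>\<pi>\<in>perms n. exp (\<bar>s\<bar> / n) * exp (- (s * L)) * exp (s * ?S \<pi>))"
    using finite_perms by (intro sum_mono2) auto
  also have "\<dots> = exp (\<bar>s\<bar> / n) * exp (- (s * L)) * (\<Sum>\<pi>\<in>perms n. exp (s * ?S \<pi>))"
    by (simp only: sum_distrib_left)
  also have "\<dots> \<le> exp (\<bar>s\<bar> / n) * exp (- (s * L)) * (fact n * exp (2 * B\<^sup>2 * s\<^sup>2))"
    using w by (intro mult_left_mono perm_sum_mgf vB n) (auto simp: admissible_weights_def)
  finally show ?thesis
    by (simp add: small_ball_prob_eq pos_divide_le_eq mult_ac)
qed

lemma small_ball_le:
  fixes w v :: "nat \<Rightarrow> real" and \<delta> A L :: real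
  assumes \<delta>: "0 < \<delta>" "\<delta> \<le> 1" and n: "n \<ge> 2" and A: "A \<ge> 2 ^ 11 / \<delta> ^ 5"
    and w: "admissible_weights A n w" and eq: "equispaced_on \<delta> n I v"
  shows "small_ball_prob n w v L \<le> (8 / sqrt (\<delta> ^ 5 / 2 ^ 23) + 8 + 8 / \<delta>) / n"
proof (cases "real n \<ge> 8 / \<delta>")
  case True
  have "small_ball_prob n w v L
      \<le> (8 / sqrt (\<delta> ^ 5 / 2 ^ 23) + 8) / n * (exp (\<bar>0\<bar> / n) * exp (- (0 * L)) * 1)"
    by (rule small_ball_tilted[OF \<delta> True A w eq]) (use card_perms[of n] in auto)
  also have "\<dots> \<le> (8 / sqrt (\<delta> ^ 5 / 2 ^ 23) + 8 + 8 / \<delta>) / n"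
    using \<delta> by (simp add: divide_right_mono)
  finally show ?thesis .
next
  case False
  \<comment> \<open>For bounded \<open>n\<close> the trivial bound suffices; this is the source of
    the summand \<open>8 / \<delta>\<close>.\<close>
  have "small_ball_prob n w v L \<le> 1" by (simp add: small_ball_prob_def)
  also have "1 \<le> (8 / \<delta>) / n" using False n by (subst pos_le_divide_eq) auto
  also have "\<dots> \<le> (8 / sqrt (\<delta> ^ 5 / 2 ^ 23) + 8 + 8 / \<delta>) / n"
    using \<delta> by (intro divide_right_mono) auto
  finally show ?thesis .
qed

text \<open>For \<open>L\<^sup>2\<close> of order at most \<open>ln n\<close> the tilt \<open>s = 2 a L\<close> is at most of the order of
  the inverse of the weight differences; for larger \<open>L\<close> the Chernoff bound already contains the
  factor \<open>1 / n\<close>.\<close>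

lemma small_ball_gaussian_le:
  fixes w v :: "nat \<Rightarrow> real" and \<delta> A B L :: real
  assumes \<delta>: "0 < \<delta>" "\<delta> \<le> 1" and n: "n \<ge> 2" and A: "A \<ge> 2 ^ 11 / \<delta> ^ 5"
    and w: "admissible_weights A n w" and eq: "equispaced_on \<delta> n I v"
    and B: "B > 0" and vB: "\<forall>i\<in>{1..n}. \<bar>v i\<bar> \<le> B"
  shows "small_ball_prob n w v L \<le> (8 / sqrt (\<delta> ^ 5 / 2 ^ 23) + 8 + 8 / \<delta>) * exp (1 / (8 * B\<^sup>2)) / n *
    exp (- (1 / (32 * B\<^sup>2)) * L\<^sup>2)"
proof -
  \<comment> \<open>With \<open>s = 2 a L\<close> the gain \<open>s L\<close> is
    \<open>2 a L\<^sup>2\<close>, while the moment factor \<open>4 B\<^sup>2 s\<^sup>2\<close> is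
    \<open>a L\<^sup>2\<close>. The ball-width cost \<open>\<bar>s\<bar> / n\<close> takes at most a
    further \<open>a L\<^sup>2 / 2 + 2 a\<close>, leaving \<open>- a L\<^sup>2 / 2\<close> in the
    exponent.\<close>
  define a where "a = 1 / (16 * B\<^sup>2)"
  define s where "s = 2 * a * L"
  define K where "K = 8 / sqrt (\<delta> ^ 5 / 2 ^ 23) + 8"
  have a: "a > 0" using B by (simp add: a_def)
  have Ba: "B\<^sup>2 = 1 / (16 * a)" using B by (simp add: a_def)
  have K: "K \<ge> 1" unfolding K_def using \<delta> by simp
  have L1: "\<bar>L\<bar> \<le> L\<^sup>2 / 4 + 1"
  proof -
    have "0 \<le> (\<bar>L\<bar> / 2 - 1)\<^sup>2" by simp
    also have "\<dots> = L\<^sup>2 / 4 - \<bar>L\<bar> + 1" by (simp add: power2_diff power_divide)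
    finally show ?thesis by simp
  qed
  have sn: "\<bar>s\<bar> / n \<le> a * L\<^sup>2 / 2 + 2 * a"
  proof -
    have "\<bar>s\<bar> / n \<le> \<bar>s\<bar> / 1" using n by (intro divide_left_mono) auto
    also have "\<dots> = 2 * a * \<bar>L\<bar>" using a by (simp add: s_def abs_mult)
    also have "\<dots> \<le> 2 * a * (L\<^sup>2 / 4 + 1)" using L1 a by (intro mult_left_mono) auto
    finally show ?thesis by (simp add: algebra_simps)
  qed
  have sL: "s * L = 2 * a * L\<^sup>2" by (simp add: s_def power2_eq_square)
  have Bs: "B\<^sup>2 * s\<^sup>2 = a * L\<^sup>2 / 4"
    using a by (simp add: Ba s_def power_mult_distrib field_simps) (simp add: power2_eq_square)
  have chernoff: "small_ball_prob n w v L \<le> exp (2 * a) * exp (- (a * L\<^sup>2))"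
  proof -
    have "small_ball_prob n w v L \<le> exp (\<bar>s\<bar> / n) * exp (- (s * L)) * exp (2 * B\<^sup>2 * s\<^sup>2)"
      using n by (intro small_ball_chernoff[OF w vB]) auto
    also have "\<dots> = exp (\<bar>s\<bar> / n + - (s * L) + 2 * B\<^sup>2 * s\<^sup>2)" by (simp only: exp_add)
    also have "\<dots> \<le> exp (2 * a + - (a * L\<^sup>2))" using sn sL Bs by simp
    finally show ?thesis by (simp only: exp_add)
  qed
  have "small_ball_prob n w v L \<le> (K + 8 / \<delta>) / n * (exp (2 * a) * exp (- (a * L\<^sup>2 / 2)))"
  proof -
    consider (small_n) "real n < 8 / \<delta>"
      | (large_L) "L\<^sup>2 > 2 / a * ln n"
      | (main) "real n \<ge> 8 / \<delta>" "L\<^sup>2 \<le> 2 / a * ln n" by linarith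
    then have "small_ball_prob n w v L \<le> K / n * (exp (2 * a) * exp (- (a * L\<^sup>2 / 2))) \<or>
        small_ball_prob n w v L \<le> 8 / \<delta> / n * (exp (2 * a) * exp (- (a * L\<^sup>2 / 2)))"
    proof cases
      case small_n
      have "1 \<le> 8 / \<delta> / n" using small_n n by (subst pos_le_divide_eq) auto
      then have le: "1 * (exp (2 * a) * exp (- (a * L\<^sup>2 / 2)))
          \<le> 8 / \<delta> / n * (exp (2 * a) * exp (- (a * L\<^sup>2 / 2)))"
        by (rule mult_right_mono) simp
      have "exp (2 * a) * exp (- (a * L\<^sup>2)) \<le> exp (2 * a) * exp (- (a * L\<^sup>2 / 2))"
        using a by (intro mult_left_mono) auto
      then show ?thesis using chernoff le by linarith
    next
      case large_L
      \<comment> \<open>Half of the Chernoff exponent exceeds \<open>ln n\<close> and yields the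
        factor \<open>1 / n\<close>.\<close>
      have "- (a * L\<^sup>2) \<le> - ln n + - (a * L\<^sup>2 / 2)"
        using large_L a by (simp add: field_simps)
      then have "exp (- (a * L\<^sup>2)) \<le> exp (- ln n + - (a * L\<^sup>2 / 2))" by simp
      also have "\<dots> = 1 / n * exp (- (a * L\<^sup>2 / 2))"
        unfolding exp_add using n by (simp add: exp_minus inverse_eq_divide)
      also have "\<dots> \<le> K / n * exp (- (a * L\<^sup>2 / 2))"
        using K by (intro mult_right_mono divide_right_mono) auto
      finally have "exp (2 * a) * exp (- (a * L\<^sup>2))
          \<le> exp (2 * a) * (K / n * exp (- (a * L\<^sup>2 / 2)))" by (rule mult_left_mono) simp
      then show ?thesis using chernoff by (simp add: mult_ac)
    next
      case main
      have ln: "ln (real n) > 0" using n by simp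
      have \<delta>5: "\<delta> ^ 5 > 0" "\<delta> ^ 5 \<le> 1" using \<delta> by (auto simp: power_le_one)
      have "1 \<le> 2 ^ 11 / \<delta> ^ 5" using \<delta>5 by (simp add: pos_le_divide_eq)
      then have A1: "A \<ge> 1" using A by linarith
      \<comment> \<open>With the weight gaps at most \<open>1 / (A sqrt (ln n))\<close>, this keeps
        the tilt of each swap below \<open>2 / A\<close>, within the range allowed for the tilted
        estimate.\<close>
      have sB: "\<bar>s\<bar> * B \<le> sqrt (ln n)"
      proof (rule real_le_rsqrt)
        have "(\<bar>s\<bar> * B)\<^sup>2 = a * L\<^sup>2 / 4" using Bs by (simp add: power_mult_distrib mult.commute)
        also have "\<dots> \<le> a * (2 / a * ln n) / 4"
          using main a by (intro divide_right_mono mult_left_mono) auto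
        also have "\<dots> \<le> ln n" using a ln by simp
        finally show "(\<bar>s\<bar> * B)\<^sup>2 \<le> ln n" .
      qed
      have "small_ball_prob n w v L \<le> K / n *
          (exp (\<bar>s\<bar> / n) * exp (- (s * L)) * exp (4 * B\<^sup>2 * s\<^sup>2))"
        unfolding K_def
      proof (rule small_ball_tilted[OF \<delta> main(1) A w eq])
        fix i j k l
        assume ij: "i \<in> {1..n}" "j \<in> {1..n}" "i \<noteq> j" and kl: "k \<in> {1..n}" "l \<in> {1..n}"
        have vv: "\<bar>v k - v l\<bar> \<le> 2 * B" using vB kl by (smt (verit))
        have ww: "\<bar>w i - w j\<bar> \<le> 1 / (A * sqrt (ln n))"
          using w ij by (auto simp: admissible_weights_def)
        have "\<bar>s * ((w i - w j) * (v k - v l))\<bar> = \<bar>w i - w j\<bar> * (\<bar>s\<bar> * \<bar>v k - v l\<bar>)"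
          by (simp add: abs_mult mult_ac)
        also have "\<dots> \<le> 1 / (A * sqrt (ln n)) * (\<bar>s\<bar> * (2 * B))"
          using ww vv A1 ln by (intro mult_mono mult_left_mono) auto
        also have "\<dots> = 2 / (A * sqrt (ln n)) * (\<bar>s\<bar> * B)" by simp
        also have "\<dots> \<le> 2 / (A * sqrt (ln n)) * sqrt (ln n)"
          using sB A1 ln by (intro mult_left_mono) auto
        also have "\<dots> = 2 / A" using ln by simp
        also have "\<dots> \<le> 2" using A1 by (simp add: field_simps)
        finally show "\<bar>s * ((w i - w j) * (v k - v l))\<bar> \<le> 2" .
      next
        have "(\<Sum>\<pi>\<in>perms n. exp (2 * s * perm_sum n w v \<pi>)) \<le> fact n * exp (2 * B\<^sup>2 * (2 * s)\<^sup>2)"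
          using w n by (intro perm_sum_mgf vB) (auto simp: admissible_weights_def)
        also have "exp (2 * B\<^sup>2 * (2 * s)\<^sup>2) = (exp (4 * B\<^sup>2 * s\<^sup>2))\<^sup>2"
          by (simp add: power_mult_distrib mult_ac flip: exp_double)
        finally show "(\<Sum>\<pi>\<in>perms n. exp (2 * s * perm_sum n w v \<pi>))
            \<le> fact n * (exp (4 * B\<^sup>2 * s\<^sup>2))\<^sup>2" .
      qed simp
      also have "exp (\<bar>s\<bar> / n) * exp (- (s * L)) * exp (4 * B\<^sup>2 * s\<^sup>2)
          = exp (\<bar>s\<bar> / n + - (s * L) + 4 * B\<^sup>2 * s\<^sup>2)" by (simp only: exp_add)
      also have "\<dots> \<le> exp (2 * a + - (a * L\<^sup>2 / 2))" using sn sL Bs by simp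
      also have "\<dots> = exp (2 * a) * exp (- (a * L\<^sup>2 / 2))" by (simp only: exp_add)
      finally show ?thesis using K by (simp add: mult_left_mono divide_right_mono)
    qed
    moreover have "0 \<le> K / n * (exp (2 * a) * exp (- (a * L\<^sup>2 / 2)))"
      "0 \<le> 8 / \<delta> / n * (exp (2 * a) * exp (- (a * L\<^sup>2 / 2)))"
      using K \<delta> by auto
    ultimately show ?thesis
      unfolding add_divide_distrib distrib_right by linarith
  qed
  moreover have "2 * a = 1 / (8 * B\<^sup>2)" "a * L\<^sup>2 / 2 = 1 / (32 * B\<^sup>2) * L\<^sup>2"
    by (simp_all add: a_def)
  ultimately show ?thesis by (simp add: K_def)
qed

theorem theorem2p6:
  fixes \<delta> :: real
  assumes "\<delta> > 0"
  shows "\<exists>A\<^sub>0>0. \<forall>A\<ge>A\<^sub>0.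
    (\<exists>K::real. \<forall>n\<ge>2. \<forall>w I v.
       admissible_weights A n w \<longrightarrow> equispaced_on \<delta> n I v \<longrightarrow>
       (\<forall>L. small_ball_prob n w v L \<le> K / real n)) \<and>
    (\<forall>B>0. \<exists>K'>0. \<exists>c>0. \<forall>n\<ge>2. \<forall>w I v.
       admissible_weights A n w \<longrightarrow> equispaced_on \<delta> n I v \<longrightarrow>
       (\<forall>i\<in>{1..n}. \<bar>v i\<bar> \<le> B) \<longrightarrow>
       (\<forall>L. small_ball_prob n w v L \<le> K' / real n * exp (- c * L\<^sup>2)))"
proof -
  \<comment> \<open>The estimates bound powers of the density by 1, so it is capped; the density
    condition is monotone and survives.\<close>
  define \<delta>' where "\<delta>' = min \<delta> 1"
  define K where "K = 8 / sqrt (\<delta>' ^ 5 / 2 ^ 23) + 8 + 8 / \<delta>'"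
  have \<delta>': "0 < \<delta>'" "\<delta>' \<le> 1" using assms by (auto simp: \<delta>'_def)
  have K: "K > 0" using \<delta>' by (simp add: K_def add_pos_pos)
  have eq: "equispaced_on \<delta>' n I v" if "equispaced_on \<delta> n I v" for n I v
    using that mult_right_mono[of \<delta>' \<delta> "real n"] by (auto simp: equispaced_on_def \<delta>'_def)
  show ?thesis
  proof (rule exI[of _ "2 ^ 11 / \<delta>' ^ 5"], intro conjI allI impI)
    show "0 < 2 ^ 11 / \<delta>' ^ 5" using \<delta>' by simp
    fix A assume A: "2 ^ 11 / \<delta>' ^ 5 \<le> A"
    show "\<exists>K::real. \<forall>n\<ge>2. \<forall>w I v.
       admissible_weights A n w \<longrightarrow> equispaced_on \<delta> n I v \<longrightarrow>
       (\<forall>L. small_ball_prob n w v L \<le> K / real n)"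
      using small_ball_le[OF \<delta>' _ A _ eq] unfolding K_def[symmetric] by blast
    fix B :: real assume B: "B > 0"
    show "\<exists>K'>0. \<exists>c>0. \<forall>n\<ge>2. \<forall>w I v.
       admissible_weights A n w \<longrightarrow> equispaced_on \<delta> n I v \<longrightarrow>
       (\<forall>i\<in>{1..n}. \<bar>v i\<bar> \<le> B) \<longrightarrow>
       (\<forall>L. small_ball_prob n w v L \<le> K' / real n * exp (- c * L\<^sup>2))"
    proof (rule exI[of _ "K * exp (1 / (8 * B\<^sup>2))"], intro exI[of _ "1 / (32 * B\<^sup>2)"] conjI allI impI)
      fix n :: nat and w I v L
      assume "2 \<le> n" "admissible_weights A n w" "equispaced_on \<delta> n I v"
        "\<forall>i\<in>{1..n}. \<bar>v i\<bar> \<le> B"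
      then show "small_ball_prob n w v L \<le> K * exp (1 / (8 * B\<^sup>2)) / real n *
          exp (- (1 / (32 * B\<^sup>2)) * L\<^sup>2)"
        unfolding K_def by (intro small_ball_gaussian_le[OF \<delta>' _ A _ eq B])
    qed (use B K in auto)
  qed
qed

end
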